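(* A point in $U$ constitutes a vertex of $P_\lambda$ if and only if it has the form $\sum_{i=1}^n a_i\chi_{A_i}$ for a tuple of $\preceq$-antichains $(A_i\subset Q^C_i,\ 1\le i\le n)$ such that for all $1\le i\le n-1$ the point $\chi_{A_i}+\chi_{A_{i+1}}$ constitutes a vertex of the $\mathfrak{sl}_{2n}$ FFLV polytope $P_{\omega^A_i+\omega^A_{i+1}}$.
   Context: Let $\lambda$ be a dominant integral weight of $\mathfrak{sp}_{2n}$ with coordinates $(a_1,\ldots,a_n)$ in the basis of fundamental weights (simple roots $\alpha_1,\ldots,\alpha_n$ with $(\alpha_i,\alpha_{i+1})<0$ and $\alpha_n$ long). Let $U=\mathbb R^{n^2}$ with coordinates $x_{i,j}$ labeled by pairs $1\le i<j\le 2n+1-i$. A type $C$ Dyck path is a sequence $d=((i_1,j_1),\ldots,(i_N,j_N))$ of such pairs with $j_1-i_1=1$, each $(i_{k+1},j_{k+1})$ equal to $(i_k+1,j_k)$ or $(i_k,j_k+1)$, and either $j_N-i_N=1$ or $i_N+j_N=2n+1$. Set $S(x,d)=\sum_{(i,j)\in d}x_{i,j}$, and $M(\lambda,d)=a_{i_1}+\ldots+a_{i_N}$ if $j_N-i_N=1$, $M(\lambda,d)=a_{i_1}+\ldots+a_n$ otherwise. The type $C$ FFLV polytope $P_\lambda\subset U$ is the set of $x$ with all $x_{i,j}\ge 0$ and $S(x,d)\le M(\lambda,d)$ for every type $C$ Dyck path $d$. For $\mathfrak{sl}_{2n}$ with fundamental weights $\omega^A_1,\ldots,\omega^A_{2n-1}$,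 let $U_A=\mathbb R^{n(2n-1)}$ with coordinates labeled by pairs $1\le i<j\le 2n$; for a dominant integral weight $\mu=\sum b_i\omega^A_i$ the (type $A$) FFLV polytope $P_\mu\subset U_A$ is the set of $x$ with all $x_{i,j}\ge0$ and $\sum_{(i,j)\in d}x_{i,j}\le b_{i_1}+b_{i_1+1}+\ldots+b_{i_N}$ for every type $A$ Dyck path $d=((i_1,j_1),\ldots,(i_N,j_N))$ (pairs $1\le i<j\le 2n$, $j_1-i_1=j_N-i_N=1$, each step going to $(i_k+1,j_k)$ or $(i_k,j_k+1)$). $U$ is identified with the subspace of $U_A$ where all coordinates $x_{i,j}$ with $i+j>2n+1$ vanish. On pairs $1\le i<j\le 2n$ define the partial order $(i_1,j_1)\preceq(i_2,j_2)$ iff $i_1\le i_2$ and $j_1\le j_2$. For $1\le i\le 2n-1$ let $Q_i=\{(k,l):1\le k\le i,\ i+1\le l\le 2n\}$, and for $1\le i\le n$ let $Q^C_i=\{(k,l)\in Q_i: k+l\le 2n+1\}$. For a set $A$ of pairs, $\chi_A$ denotes its indicator function, viewed as a point of $U$ (or $U_A$). *)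

theory Defs
  imports "HOL-Analysis.Analysis" "HOL-Analysis.Finite_Function_Topology"
begin

text \<open>
  Points are finitely supported functions on pairs of naturals, which the library makes a real
  vector space. The coordinate space over a finite set I of pairs is the subspace of
  functions supported in I. The subspace of functions supported on the type C pairs thus literally
  lies inside the one for the type A pairs, so that the identification of U with the subspace of
  \<open>U\<^sub>A\<close> on which the coordinates with \<open>i + j > 2n + 1\<close> vanish is an inclusion.
\<close>

type_synonym point = "(nat \<times> nat) \<Rightarrow>\<^sub>0 real"

definition coord_space :: "(nat \<times> nat) set \<Rightarrow> point set" where
  "coord_space I = {x. Poly_Mapping.keys x \<subseteq> I}"

definition chi :: "(nat \<times> nat) set \<Rightarrow> point" where
  "chi A = (\<Sum>p\<in>A. Poly_Mapping.single p 1)"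

lemma lookup_chi:
  assumes "finite A"
  shows "Poly_Mapping.lookup (chi A) p = indicator A p"
  using assms
  by (simp add: chi_def Poly_Mapping.lookup_sum lookup_single when_def sum.delta' indicator_def)

definition pair_le :: "nat \<times> nat \<Rightarrow> nat \<times> nat \<Rightarrow> bool" (infix \<open>\<preceq>\<close> 50) where
  "p \<preceq> q \<longleftrightarrow> fst p \<le> fst q \<and> snd p \<le> snd q"

definition antichain :: "(nat \<times> nat) set \<Rightarrow> bool" where
  "antichain A \<longleftrightarrow> (\<forall>p\<in>A. \<forall>q\<in>A. p \<preceq> q \<longrightarrow> p = q)"

definition dyck_step :: "nat \<times> nat \<Rightarrow> nat \<times> nat \<Rightarrow> bool" where
  "dyck_step p q \<longleftrightarrow> q = (fst p + 1, snd p) \<or> q = (fst p, snd p + 1)"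

text \<open>Type A objects are indexed by m for \<open>sl\<^sub>m\<close>, type C objects by n for \<open>sp\<^sub>2\<^sub>n\<close>.\<close>

definition pairsA :: "nat \<Rightarrow> (nat \<times> nat) set" where
  "pairsA m = {(i, j). 1 \<le> i \<and> i < j \<and> j \<le> m}"

definition pairsC :: "nat \<Rightarrow> (nat \<times> nat) set" where
  "pairsC n = {(i, j). 1 \<le> i \<and> i < j \<and> i + j \<le> 2 * n + 1}"

definition dyck_pathA :: "nat \<Rightarrow> (nat \<times> nat) list \<Rightarrow> bool" where
  "dyck_pathA m d \<longleftrightarrow>
     d \<noteq> [] \<and> set d \<subseteq> pairsA m \<and> successively dyck_step d \<and>
     snd (hd d) = fst (hd d) + 1 \<and> snd (last d) = fst (last d) + 1"

definition dyck_pathC :: "nat \<Rightarrow> (nat \<times> nat) list \<Rightarrow> bool" where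
  "dyck_pathC n d \<longleftrightarrow>
     d \<noteq> [] \<and> set d \<subseteq> pairsC n \<and> successively dyck_step d \<and>
     snd (hd d) = fst (hd d) + 1 \<and>
     (snd (last d) = fst (last d) + 1 \<or> fst (last d) + snd (last d) = 2 * n + 1)"

text \<open>The elements of a Dyck path are pairwise distinct, hence the sum over the set.\<close>

definition path_sum :: "point \<Rightarrow> (nat \<times> nat) list \<Rightarrow> real" where
  "path_sum x d = (\<Sum>p\<in>set d. Poly_Mapping.lookup x p)"

text \<open>
  A dominant integral weight is given by its coordinates in the basis of fundamental weights, which
  are natural numbers; only the values at \<open>1, \<dots>, n\<close> (for \<open>sp\<^sub>2\<^sub>n\<close>) or \<open>1, \<dots>, m - 1\<close>
  (for \<open>sl\<^sub>m\<close>) are ever used.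
\<close>

type_synonym weight = "nat \<Rightarrow> nat"

definition omegaA :: "nat \<Rightarrow> weight" where
  "omegaA i = (\<lambda>k. if k = i then 1 else 0)"

definition boundA :: "weight \<Rightarrow> (nat \<times> nat) list \<Rightarrow> nat" where
  "boundA b d = (\<Sum>k = fst (hd d)..fst (last d). b k)"

definition boundC :: "nat \<Rightarrow> weight \<Rightarrow> (nat \<times> nat) list \<Rightarrow> nat" where
  "boundC n a d =
     (if snd (last d) = fst (last d) + 1
      then \<Sum>k = fst (hd d)..fst (last d). a k
      else \<Sum>k = fst (hd d)..n. a k)"

definition FFLV_A :: "nat \<Rightarrow> weight \<Rightarrow> point set" where
  "FFLV_A m b =
     {x \<in> coord_space (pairsA m).
        (\<forall>p\<in>pairsA m. 0 \<le> Poly_Mapping.lookup x p) \<and>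
        (\<forall>d. dyck_pathA m d \<longrightarrow> path_sum x d \<le> real (boundA b d))}"

definition FFLV_C :: "nat \<Rightarrow> weight \<Rightarrow> point set" where
  "FFLV_C n a =
     {x \<in> coord_space (pairsC n).
        (\<forall>p\<in>pairsC n. 0 \<le> Poly_Mapping.lookup x p) \<and>
        (\<forall>d. dyck_pathC n d \<longrightarrow> path_sum x d \<le> real (boundC n a d))}"

definition Q :: "nat \<Rightarrow> nat \<Rightarrow> (nat \<times> nat) set" where
  "Q m i = {(k, l). 1 \<le> k \<and> k \<le> i \<and> i + 1 \<le> l \<and> l \<le> m}"

definition QC :: "nat \<Rightarrow> nat \<Rightarrow> (nat \<times> nat) set" where
  "QC n i = {(k, l) \<in> Q (2 * n) i. k + l \<le> 2 * n + 1}"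

end

theory Submission
  imports Defs
begin

text \<open>
  Both implications rest on tight chains and level sets of marked chain polytopes.

  Every \<open>x\<close> in a type A polytope is the sequence of drops of a potential with value \<open>b\<^sub>i + b\<^sub>i\<^sub>+\<^sub>1 + \<dots>\<close>
  at \<open>(i, i)\<close>; the pairs at which the potential crosses a level \<open>t\<close> form an antichain inside \<open>Q\<^sub>i\<close>, and
  \<open>x\<close> is the integral over \<open>t\<close> of their indicators. Hence the support function of \<open>P\<^sub>\<mu>\<close> is the sum of the
  \<open>b\<^sub>i\<close> times the maxima over antichains in \<open>Q\<^sub>i\<close>. The type C polytope is a face of a type A one. A vertex
  is exposed by some functional; a generic perturbation of it has a unique maximizer \<open>A\<^sub>i\<close> among the
  antichains of each \<open>Q\<^sup>C\<^sub>i\<close>, and these \<open>A\<^sub>i\<close> are the required tuple.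

  Conversely, that \<open>\<chi>\<^sub>A + \<chi>\<^sub>B\<close> is a vertex for two consecutive antichains means that \<open>B\<close> lies above \<open>A\<close>
  and that a function on the symmetric difference which is constant along the relations \<open>p \<preceq> q\<close> and
  zero next to the marked position \<open>(i + 1, i + 1)\<close> vanishes. If \<open>v\<close> is a direction that keeps all tight
  chains tight, then the sums of \<open>v\<close> over the lower halves of tight chains give such functions for each
  \<open>i\<close>, and \<open>v = 0\<close> follows.
\<close>

section \<open>The order on pairs, coordinates and path sums as linear functionals\<close>

abbreviation coeff_at :: "point \<Rightarrow> nat \<times> nat \<Rightarrow> real" where
  "coeff_at \<equiv> Poly_Mapping.lookup"

lemma pair_le_refl [simp]: "p \<preceq> p"
  by (simp add: pair_le_def)

lemma pair_le_trans: "p \<preceq> q \<Longrightarrow> q \<preceq> r \<Longrightarrow> p \<preceq> r"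
  by (auto simp: pair_le_def)

lemma pair_le_antisym: "p \<preceq> q \<Longrightarrow> q \<preceq> p \<Longrightarrow> p = q"
  by (auto simp: pair_le_def prod_eq_iff)

lemma antichainD: "antichain A \<Longrightarrow> p \<in> A \<Longrightarrow> q \<in> A \<Longrightarrow> p \<preceq> q \<Longrightarrow> p = q"
  by (auto simp: antichain_def)

lemma antichain_subset: "antichain A \<Longrightarrow> B \<subseteq> A \<Longrightarrow> antichain B"
  by (auto simp: antichain_def)

lemma finite_pairsA: "finite (pairsA m)"
  by (rule finite_subset[of _ "{..m} \<times> {..m}"]) (auto simp: pairsA_def)

lemma pairsC_subset_pairsA: "pairsC n \<subseteq> pairsA (2 * n)"
  by (auto simp: pairsC_def pairsA_def)

lemma finite_pairsC: "finite (pairsC n)"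
  using finite_subset[OF pairsC_subset_pairsA finite_pairsA] .

lemma Q_subset_pairsA: "Q m i \<subseteq> pairsA m"
  by (auto simp: Q_def pairsA_def)

lemma finite_Q: "finite (Q m i)"
  using finite_subset[OF Q_subset_pairsA finite_pairsA] .

lemma QC_subset_Q: "QC n i \<subseteq> Q (2 * n) i"
  by (auto simp: QC_def)

lemma QC_subset_pairsC: "QC n i \<subseteq> pairsC n"
  by (auto simp: QC_def Q_def pairsC_def)

lemma finite_QC: "finite (QC n i)"
  using finite_subset[OF QC_subset_pairsC finite_pairsC] .

lemma Q_inter_pairsC_subset_QC: "Q (2 * n) i \<inter> pairsC n \<subseteq> QC n i"
  by (auto simp: QC_def pairsC_def)

lemma lookup_scaleR: "coeff_at (c *\<^sub>R x) p = c * coeff_at x p"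
proof -
  have "finite {i. c *\<^sub>R coeff_at x i \<noteq> 0}"
    by (rule finite_subset[OF _ finite_keys[of x]]) (auto simp: in_keys_iff)
  then show ?thesis by (simp add: scaleR_poly_mapping_def)
qed

lemma coeff_zero_outside: "x \<in> coord_space I \<Longrightarrow> p \<notin> I \<Longrightarrow> coeff_at x p = 0"
  by (auto simp: coord_space_def in_keys_iff)

lemma coord_spaceI: "(\<And>p. p \<notin> I \<Longrightarrow> coeff_at x p = 0) \<Longrightarrow> x \<in> coord_space I"
  by (auto simp: coord_space_def in_keys_iff)

lemma coeff_sum_chi:
  assumes "\<And>i. i \<in> I \<Longrightarrow> finite (A i)"
  shows "coeff_at (\<Sum>i\<in>I. c i *\<^sub>R chi (A i)) p = (\<Sum>i\<in>I. c i * indicator (A i) p)"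
  using assms by (simp add: lookup_sum lookup_scaleR lookup_chi)

lemma linear_coeff_at: "linear (\<lambda>x. coeff_at x p)"
  by (rule linearI) (simp_all add: lookup_add lookup_scaleR)

lemma path_sum_add: "path_sum (x + y) d = path_sum x d + path_sum y d"
  by (simp add: path_sum_def lookup_add sum.distrib)

lemma path_sum_scaleR: "path_sum (c *\<^sub>R x) d = c * path_sum x d"
  by (simp add: path_sum_def lookup_scaleR sum_distrib_left)

lemma linear_path_sum: "linear (\<lambda>x. path_sum x d)"
  by (rule linearI) (simp_all add: path_sum_add path_sum_scaleR)

section \<open>Lattice paths\<close>

text \<open>Each step increases strictly in \<open>\<preceq>\<close>, and transitivity extends this
  from neighbours to all positions. Paths are thus chains, and a chain meets an antichain at most
  once.\<close>

lemma dyck_sorted: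
  assumes "successively dyck_step d"
  shows "sorted_wrt (\<lambda>p q. p \<preceq> q \<and> p \<noteq> q) d"
proof -
  have "successively (\<lambda>p q. p \<preceq> q \<and> p \<noteq> q) d"
    using assms by (rule successively_mono) (auto simp: dyck_step_def pair_le_def prod_eq_iff)
  moreover have "transp (\<lambda>p q. p \<preceq> q \<and> p \<noteq> q)"
    by (auto simp: transp_def pair_le_def prod_eq_iff)
  ultimately show ?thesis
    by (simp add: successively_conv_sorted_wrt)
qed

lemma dyck_distinct: "successively dyck_step d \<Longrightarrow> distinct d"
proof -
  assume "successively dyck_step d"
  then have "sorted_wrt (\<lambda>p q. p \<preceq> q \<and> p \<noteq> q) d" by (rule dyck_sorted)
  then show "distinct d"
    by (induction d) auto
qed

lemma dyck_comparable:
  assumes "successively dyck_step d" "p \<in> set d" "q \<in> set d"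
  shows "p \<preceq> q \<or> q \<preceq> p"
proof -
  have "sorted_wrt (\<lambda>p q. p \<preceq> q \<and> p \<noteq> q) d" using assms(1) by (rule dyck_sorted)
  then show ?thesis using assms(2,3)
    by (induction d) auto
qed

lemma dyck_hd_le:
  assumes "successively dyck_step d" "p \<in> set d"
  shows "hd d \<preceq> p"
  using dyck_sorted[OF assms(1)] assms(2) by (cases d) auto

lemma dyck_le_last:
  assumes "successively dyck_step d" "p \<in> set d"
  shows "p \<preceq> last d"
proof -
  have "sorted_wrt (\<lambda>p q. p \<preceq> q \<and> p \<noteq> q) d" using assms(1) by (rule dyck_sorted)
  then show ?thesis using assms(2) by (induction d) auto
qed

lemma dyck_meets_antichain_once:
  assumes "successively dyck_step d" "antichain A" "p \<in> set d" "p \<in> A" "q \<in> set d" "q \<in> A"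
  shows "p = q"
  using dyck_comparable[OF assms(1,3,5)] antichainD[OF assms(2)] assms(4,6) by metis

lemma card_dyck_antichain:
  assumes "successively dyck_step d" "antichain A"
  shows "card (set d \<inter> A) = (if set d \<inter> A = {} then 0 else 1)"
proof (cases "set d \<inter> A = {}")
  case False
  then obtain p where p: "p \<in> set d" "p \<in> A" by auto
  have "set d \<inter> A = {p}"
    using p dyck_meets_antichain_once[OF assms p] by blast
  then show ?thesis by simp
qed simp

lemma path_sum_chi:
  assumes "successively dyck_step d" "antichain A" "finite A"
  shows "path_sum (chi A) d = (if set d \<inter> A = {} then 0 else 1)"
proof -
  have "path_sum (chi A) d = (\<Sum>p\<in>set d. indicator A p)"
    by (simp add: path_sum_def lookup_chi assms(3))
  also have "\<dots> = real (card (set d \<inter> A))"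
    by (simp add: sum.inter_restrict[symmetric] indicator_def of_bool_def)
  finally show ?thesis using card_dyck_antichain[OF assms(1,2)] by simp
qed

lemma path_sum_sum_chi:
  assumes "successively dyck_step d" "\<And>i. i \<in> I \<Longrightarrow> antichain (A i)" "\<And>i. i \<in> I \<Longrightarrow> finite (A i)"
  shows "path_sum (\<Sum>i\<in>I. c i *\<^sub>R chi (A i)) d = (\<Sum>i\<in>I. if set d \<inter> A i = {} then 0 else c i)"
proof -
  have "path_sum (\<Sum>i\<in>I. c i *\<^sub>R chi (A i)) d = (\<Sum>i\<in>I. c i * path_sum (chi (A i)) d)"
    using linear_sum[OF linear_path_sum[of d], of "\<lambda>i. c i *\<^sub>R chi (A i)" I]
    by (simp add: path_sum_scaleR)
  also have "\<dots> = (\<Sum>i\<in>I. if set d \<inter> A i = {} then 0 else c i)"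
    using assms by (intro sum.cong) (simp_all add: path_sum_chi)
  finally show ?thesis .
qed

section \<open>Lattice paths between comparable pairs\<close>

definition lattice_path :: "(nat \<times> nat) set \<Rightarrow> nat \<times> nat \<Rightarrow> nat \<times> nat \<Rightarrow> (nat \<times> nat) list \<Rightarrow> bool" where
  "lattice_path S p q d \<longleftrightarrow>
     d \<noteq> [] \<and> set d \<subseteq> S \<and> successively dyck_step d \<and> hd d = p \<and> last d = q"

lemma lattice_path_snoc:
  assumes "lattice_path S p q d" "dyck_step q r" "r \<in> S"
  shows "lattice_path S p r (d @ [r])"
  using assms by (auto simp: lattice_path_def successively_append_iff)

lemma lattice_path_append:
  assumes "lattice_path S p q d" "lattice_path S q r e"
  shows "lattice_path S p r (d @ tl e) \<and> set (d @ tl e) = set d \<union> set e"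
proof (cases e)
  case (Cons q' e')
  show ?thesis
  proof (cases e')
    case Nil
    then show ?thesis using assms Cons by (auto simp: lattice_path_def)
  next
    case (Cons r' e'')
    then show ?thesis using assms \<open>e = q' # e'\<close>
      by (auto simp: lattice_path_def successively_append_iff)
  qed
qed (use assms in \<open>simp add: lattice_path_def\<close>)

lemma lattice_path_up:
  assumes "j \<le> j'" "\<And>l. j \<le> l \<Longrightarrow> l \<le> j' \<Longrightarrow> (i, l) \<in> S"
  shows "\<exists>d. lattice_path S (i, j) (i, j') d"
  using assms
proof (induction j' rule: dec_induct)
  case base
  then show ?case by (intro exI[of _ "[(i, j)]"]) (simp add: lattice_path_def)
next
  case (step l)
  then obtain d where "lattice_path S (i, j) (i, l) d" by auto
  then have "lattice_path S (i, j) (i, Suc l) (d @ [(i, Suc l)])"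
    by (rule lattice_path_snoc) (use step in \<open>auto simp: dyck_step_def\<close>)
  then show ?case by blast
qed

lemma lattice_path_right:
  assumes "i \<le> i'" "\<And>k. i \<le> k \<Longrightarrow> k \<le> i' \<Longrightarrow> (k, j) \<in> S"
  shows "\<exists>d. lattice_path S (i, j) (i', j) d"
  using assms
proof (induction i' rule: dec_induct)
  case base
  then show ?case by (intro exI[of _ "[(i, j)]"]) (simp add: lattice_path_def)
next
  case (step k)
  then obtain d where "lattice_path S (i, j) (k, j) d" by auto
  then have "lattice_path S (i, j) (Suc k, j) (d @ [(Suc k, j)])"
    by (rule lattice_path_snoc) (use step in \<open>auto simp: dyck_step_def\<close>)
  then show ?case by blast
qed

text \<open>The path first raises the second coordinate and then the first, so it never reaches the
  diagonal. The condition on \<open>S\<close> is phrased through order intervals because both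
  \<open>pairsA m\<close> and \<open>pairsC n\<close> contain the part above the diagonal of every
  interval between their elements.\<close>

lemma lattice_path_exists:
  assumes "p \<preceq> q" and "\<And>r. p \<preceq> r \<Longrightarrow> r \<preceq> q \<Longrightarrow> fst r < snd r \<Longrightarrow> r \<in> S"
    and "fst p < snd p" "fst q < snd q"
  shows "\<exists>d. lattice_path S p q d"
proof -
  obtain d where "lattice_path S (fst p, snd p) (fst p, snd q) d"
    using assms lattice_path_up[of "snd p" "snd q" "fst p" S] by (auto simp: pair_le_def)
  moreover obtain e where "lattice_path S (fst p, snd q) (fst q, snd q) e"
    using assms lattice_path_right[of "fst p" "fst q" "snd q" S] by (auto simp: pair_le_def)
  ultimately show ?thesis
    using lattice_path_append[of S "(fst p, snd p)" "(fst p, snd q)" d "(fst q, snd q)" e] by auto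
qed

lemma lattice_path_pairsA:
  assumes "p \<in> pairsA m" "q \<in> pairsA m" "p \<preceq> q"
  shows "\<exists>d. lattice_path (pairsA m) p q d"
  using assms by (intro lattice_path_exists) (auto simp: pair_le_def pairsA_def)

lemma lattice_path_pairsC:
  assumes "p \<in> pairsC n" "q \<in> pairsC n" "p \<preceq> q"
  shows "\<exists>d. lattice_path (pairsC n) p q d"
  using assms by (intro lattice_path_exists) (auto simp: pair_le_def pairsC_def)

section \<open>Sums of antichains lie in the polytopes\<close>

text \<open>A path through a point of \<open>Q m i\<close> starts in a row at most \<open>i\<close>
  and ends in a row at least \<open>i\<close>, so \<open>b i\<close> occurs in its bound. Each
  antichain is met at most once, so \<open>b i\<close> is collected at most once.\<close>

lemma sum_chi_in_FFLV_A:
  assumes "finite I" "\<And>i. i \<in> I \<Longrightarrow> A i \<subseteq> Q m i" "\<And>i. i \<in> I \<Longrightarrow> antichain (A i)"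
    and "\<And>k. k \<notin> I \<Longrightarrow> b k = 0"
  shows "(\<Sum>i\<in>I. real (b i) *\<^sub>R chi (A i)) \<in> FFLV_A m b"
proof -
  let ?x = "\<Sum>i\<in>I. real (b i) *\<^sub>R chi (A i)"
  have fin: "finite (A i)" if "i \<in> I" for i
    using assms(2)[OF that] finite_Q finite_subset by blast
  have coeff: "coeff_at ?x p = (\<Sum>i\<in>I. real (b i) * indicator (A i) p)" for p
    using fin by (rule coeff_sum_chi)
  have "?x \<in> coord_space (pairsA m)"
  proof (rule coord_spaceI)
    fix p assume "p \<notin> pairsA m"
    then have "p \<notin> A i" if "i \<in> I" for i using assms(2)[OF that] Q_subset_pairsA by blast
    then show "coeff_at ?x p = 0" by (simp add: coeff)
  qed
  moreover have "0 \<le> coeff_at ?x p" for p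
    unfolding coeff by (intro sum_nonneg) auto
  moreover have "path_sum ?x d \<le> real (boundA b d)" if d: "dyck_pathA m d" for d
  proof -
    have sd: "successively dyck_step d" using d by (simp add: dyck_pathA_def)
    have "path_sum ?x d = (\<Sum>i\<in>I. if set d \<inter> A i = {} then 0 else real (b i))"
      using sd assms(3) fin by (rule path_sum_sum_chi)
    also have "\<dots> \<le> (\<Sum>i\<in>I. if i \<in> {fst (hd d)..fst (last d)} then real (b i) else 0)"
    proof (rule sum_mono)
      fix i assume i: "i \<in> I"
      show "(if set d \<inter> A i = {} then 0 else real (b i))
        \<le> (if i \<in> {fst (hd d)..fst (last d)} then real (b i) else 0)"
      proof (cases "set d \<inter> A i = {}")
        case False
        then obtain p where p: "p \<in> set d" "p \<in> Q m i" using assms(2)[OF i] by auto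
        then have "fst (hd d) \<le> i" "i \<le> fst (last d)"
          using dyck_hd_le[OF sd p(1)] dyck_le_last[OF sd p(1)] d
          by (auto simp: pair_le_def Q_def dyck_pathA_def)
        then show ?thesis by simp
      qed simp
    qed
    also have "\<dots> = (\<Sum>i\<in>I \<inter> {fst (hd d)..fst (last d)}. real (b i))"
      using assms(1) by (simp add: sum.inter_restrict)
    also have "\<dots> \<le> (\<Sum>i\<in>{fst (hd d)..fst (last d)}. real (b i))"
      by (rule sum_mono2) auto
    finally show ?thesis by (simp add: boundA_def)
  qed
  ultimately show ?thesis by (simp add: FFLV_A_def)
qed

lemma chi_add_in_FFLV_A:
  assumes "A \<subseteq> Q m i" "antichain A" "B \<subseteq> Q m (i + 1)" "antichain B"
  shows "chi A + chi B \<in> FFLV_A m (\<lambda>k. omegaA i k + omegaA (i + 1) k)"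
proof -
  let ?C = "\<lambda>k. if k = i then A else B"
  have "(\<Sum>k\<in>{i, i + 1}. real (omegaA i k + omegaA (i + 1) k) *\<^sub>R chi (?C k))
      \<in> FFLV_A m (\<lambda>k. omegaA i k + omegaA (i + 1) k)"
    by (rule sum_chi_in_FFLV_A) (use assms in \<open>auto simp: omegaA_def\<close>)
  then show ?thesis by (simp add: omegaA_def)
qed

text \<open>The argument is the one for type A. For a path that ends on the antidiagonal the bound
  runs up to \<open>n\<close>, so only the start of the path has to be compared with
  \<open>i\<close>.\<close>

lemma sum_chi_in_FFLV_C:
  assumes "\<And>i. i \<in> {1..n} \<Longrightarrow> A i \<subseteq> QC n i" "\<And>i. i \<in> {1..n} \<Longrightarrow> antichain (A i)"
  shows "(\<Sum>i=1..n. real (a i) *\<^sub>R chi (A i)) \<in> FFLV_C n a"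
proof -
  let ?x = "\<Sum>i=1..n. real (a i) *\<^sub>R chi (A i)"
  have fin: "finite (A i)" if "i \<in> {1..n}" for i
    using assms(1)[OF that] finite_QC finite_subset by blast
  have coeff: "coeff_at ?x p = (\<Sum>i=1..n. real (a i) * indicator (A i) p)" for p
    using fin by (rule coeff_sum_chi)
  have "?x \<in> coord_space (pairsC n)"
  proof (rule coord_spaceI)
    fix p assume "p \<notin> pairsC n"
    then have "p \<notin> A i" if "i \<in> {1..n}" for i using assms(1)[OF that] QC_subset_pairsC by blast
    then show "coeff_at ?x p = 0" unfolding coeff by (intro sum.neutral) auto
  qed
  moreover have "0 \<le> coeff_at ?x p" for p
    unfolding coeff by (intro sum_nonneg) auto
  moreover have "path_sum ?x d \<le> real (boundC n a d)" if d: "dyck_pathC n d" for d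
  proof -
    have sd: "successively dyck_step d" using d by (simp add: dyck_pathC_def)
    define J where "J = {fst (hd d)..if snd (last d) = fst (last d) + 1 then fst (last d) else n}"
    have "path_sum ?x d = (\<Sum>i=1..n. if set d \<inter> A i = {} then 0 else real (a i))"
      using sd assms(2) fin by (rule path_sum_sum_chi)
    also have "\<dots> \<le> (\<Sum>i=1..n. if i \<in> J then real (a i) else 0)"
    proof (rule sum_mono)
      fix i assume i: "i \<in> {1..n}"
      show "(if set d \<inter> A i = {} then 0 else real (a i)) \<le> (if i \<in> J then real (a i) else 0)"
      proof (cases "set d \<inter> A i = {}")
        case False
        then obtain p where p: "p \<in> set d" "p \<in> QC n i" using assms(1)[OF i] by auto
        then have "i \<in> J"
          using dyck_hd_le[OF sd p(1)] dyck_le_last[OF sd p(1)] i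
          by (auto simp: pair_le_def Q_def QC_def J_def)
        then show ?thesis by simp
      qed simp
    qed
    also have "\<dots> = (\<Sum>i\<in>{1..n} \<inter> J. real (a i))"
      by (subst sum.inter_restrict) auto
    also have "\<dots> \<le> (\<Sum>i\<in>J. real (a i))"
      by (rule sum_mono2) (auto simp: J_def)
    also have "\<dots> = real (boundC n a d)"
      by (simp add: boundC_def J_def)
    finally show ?thesis .
  qed
  ultimately show ?thesis by (simp add: FFLV_C_def)
qed

section \<open>Linear functionals on the type A polytope\<close>

text \<open>
  The transfer map from the marked chain polytope to the marked order polytope: the potential is
  \<open>L i\<close> at the marked positions \<open>(i, i)\<close>, and a point \<open>x\<close> is recovered from it as the drop of the
  potential at each pair.
\<close>

function potential :: "(nat \<Rightarrow> real) \<Rightarrow> point \<Rightarrow> nat \<Rightarrow> nat \<Rightarrow> real" where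
  "potential L x i j =
     (if j \<le> i then L i
      else (if i \<le> 1 then potential L x i (j - 1)
            else min (potential L x (i - 1) j) (potential L x i (j - 1))) - coeff_at x (i, j))"
  by auto
termination by (relation "Wellfounded.measure (\<lambda>(L, x, i, j). i + j)") auto

declare potential.simps [simp del]

text \<open>For a pair above the diagonal this is the value of the potential just before the drop:
  the minimum over the preceding positions. The levels crossed at \<open>p\<close> lie between
  \<open>potential\<close> and \<open>entry\<close>, an interval of length
  \<open>coeff_at x p\<close>.\<close>

definition entry :: "(nat \<Rightarrow> real) \<Rightarrow> point \<Rightarrow> nat \<times> nat \<Rightarrow> real" where
  "entry L x p = potential L x (fst p) (snd p) + coeff_at x p"

lemma potential_diag: "potential L x i i = L i"
  by (simp add: potential.simps)

lemma entry_le_left: "i < j \<Longrightarrow> entry L x (i, j) \<le> potential L x i (j - 1)"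
  by (simp add: entry_def potential.simps[of L x i j])

lemma entry_le_above: "i < j \<Longrightarrow> 2 \<le> i \<Longrightarrow> entry L x (i, j) \<le> potential L x (i - 1) j"
  by (simp add: entry_def potential.simps[of L x i j])

context
  fixes m :: nat and b :: weight and x :: point and L :: "nat \<Rightarrow> real"
  assumes x: "x \<in> FFLV_A m b"
    and L: "\<And>k. L k = (\<Sum>l=k..<m. real (b l))"
begin

lemma coeff_nonneg: "0 \<le> coeff_at x p"
  using x coeff_zero_outside[of x "pairsA m" p] by (cases "p \<in> pairsA m") (auto simp: FFLV_A_def)

lemma potential_le_entry: "potential L x i j \<le> entry L x (i, j)"
  using coeff_nonneg[of "(i, j)"] by (simp add: entry_def)

lemma potential_antimono_right:
  assumes "j \<le> j'" "i \<le> j" shows "potential L x i j' \<le> potential L x i j"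
  using assms
proof (induction j' rule: dec_induct)
  case (step l)
  have "potential L x i (Suc l) \<le> entry L x (i, Suc l)" by (rule potential_le_entry)
  also have "\<dots> \<le> potential L x i l" using entry_le_left[of i "Suc l"] step by simp
  finally show ?case using step by simp
qed simp

lemma potential_antimono_left:
  assumes "i \<le> i'" "1 \<le> i" "i' < j" shows "potential L x i' j \<le> potential L x i j"
  using assms
proof (induction i' rule: dec_induct)
  case (step l)
  have "potential L x (Suc l) j \<le> entry L x (Suc l, j)" by (rule potential_le_entry)
  also have "\<dots> \<le> potential L x l j" using entry_le_above[of "Suc l" j] step by simp
  finally show ?case using step by simp
qed simp

lemma potential_antimono:
  assumes "i \<le> i'" "j \<le> j'" "1 \<le> i" "i \<le> j" "i' < j'"
  shows "potential L x i' j' \<le> potential L x i j"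
  using potential_antimono_left[of i i' j'] potential_antimono_right[of j j' i] assms by simp

lemma entry_le_mark: "1 \<le> i \<Longrightarrow> i < j \<Longrightarrow> entry L x (i, j) \<le> L i"
  using entry_le_left[of i j L x] potential_antimono_right[of i "j - 1" i] potential_diag[of L x i]
  by linarith

text \<open>Going back from \<open>(i, j)\<close> to the neighbour that attains the minimum, again
  and again, ends at a marked position \<open>(r, r)\<close>. The drops along this path account for
  the whole difference from \<open>L r\<close>.\<close>

lemma potential_path:
  assumes "(i, j) \<in> pairsA m"
  shows "\<exists>r d. 1 \<le> r \<and> r \<le> i \<and> lattice_path (pairsA m) (r, r + 1) (i, j) d \<and>
    potential L x i j = L r - path_sum x d"
  using assms
proof (induction "i + j" arbitrary: i j rule: less_induct)
  case less
  have ij: "1 \<le> i" "i < j" "j \<le> m" using less.prems by (auto simp: pairsA_def)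
  have extend: ?case
    if q: "q \<in> pairsA m" "fst q + snd q < i + j" "dyck_step q (i, j)" "fst q \<le> i"
      and y: "potential L x i j = potential L x (fst q) (snd q) - coeff_at x (i, j)" for q
  proof -
    obtain r d where d: "1 \<le> r" "r \<le> fst q" "lattice_path (pairsA m) (r, r + 1) q d"
      "potential L x (fst q) (snd q) = L r - path_sum x d"
      using less.hyps[of "fst q" "snd q"] q by auto
    have p: "lattice_path (pairsA m) (r, r + 1) (i, j) (d @ [(i, j)])"
      using lattice_path_snoc[OF d(3) q(3) less.prems] .
    then have "distinct (d @ [(i, j)])" by (intro dyck_distinct) (simp add: lattice_path_def)
    then have "path_sum x (d @ [(i, j)]) = path_sum x d + coeff_at x (i, j)"
      by (simp add: path_sum_def)
    then show ?case using p d q y by (intro exI[of _ r] exI[of _ "d @ [(i, j)]"]) auto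
  qed
  consider "j = i + 1" "potential L x i j = potential L x i (j - 1) - coeff_at x (i, j)"
    | "j > i + 1" "potential L x i j = potential L x i (j - 1) - coeff_at x (i, j)"
    | "2 \<le> i" "potential L x i j = potential L x (i - 1) j - coeff_at x (i, j)"
  proof -
    have "potential L x i j = potential L x i (j - 1) - coeff_at x (i, j) \<or>
        2 \<le> i \<and> potential L x i j = potential L x (i - 1) j - coeff_at x (i, j)"
      using ij potential.simps[of L x i j] by (auto simp: min_def)
    moreover have "j = i + 1 \<or> j > i + 1" using ij by auto
    ultimately show thesis using that by blast
  qed
  then show ?case
  proof cases
    case 1
    then show ?thesis using ij less.prems
      by (intro exI[of _ i] exI[of _ "[(i, j)]"])
        (simp add: lattice_path_def path_sum_def potential_diag)
  next
    case 2
    then show ?thesis using ij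
      by (intro extend[of "(i, j - 1)"]) (auto simp: pairsA_def dyck_step_def)
  next
    case 3
    then show ?thesis using ij
      by (intro extend[of "(i - 1, j)"]) (auto simp: pairsA_def dyck_step_def)
  qed
qed

text \<open>The path that computes the potential is prolonged to \<open>(j - 1, j)\<close>. The Dyck
  inequality for the prolonged path bounds the total drop by \<open>L r - L j\<close>; this is how
  the path inequalities enter the analysis of the potential.\<close>

lemma potential_ge_mark:
  assumes "(i, j) \<in> pairsA m"
  shows "L j \<le> potential L x i j"
proof -
  have ij: "1 \<le> i" "i < j" "j \<le> m" using assms by (auto simp: pairsA_def)
  obtain r d where d: "1 \<le> r" "r \<le> i" "lattice_path (pairsA m) (r, r + 1) (i, j) d"
    "potential L x i j = L r - path_sum x d"
    using potential_path[OF assms] by auto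
  obtain e where e: "lattice_path (pairsA m) (i, j) (j - 1, j) e"
    using lattice_path_pairsA[of "(i, j)" m "(j - 1, j)"] ij
    by (fastforce simp: pairsA_def pair_le_def)
  define c where "c = d @ tl e"
  have c: "lattice_path (pairsA m) (r, r + 1) (j - 1, j) c" "set c = set d \<union> set e"
    using lattice_path_append[OF d(3) e] by (auto simp: c_def)
  have "dyck_pathA m c" using c(1) ij by (auto simp: lattice_path_def dyck_pathA_def)
  then have "path_sum x c \<le> real (boundA b c)" using x by (simp add: FFLV_A_def)
  also have "boundA b c = (\<Sum>k=r..<j. b k)"
    using c(1) ij by (auto simp: boundA_def lattice_path_def intro!: sum.cong)
  also have "real (\<Sum>k=r..<j. b k) = L r - L j"
    using sum.atLeastLessThan_concat[of r j m "\<lambda>k. real (b k)"] d(2) ij by (simp add: L)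
  finally have "path_sum x c \<le> L r - L j" .
  moreover have "path_sum x d \<le> path_sum x c"
    unfolding path_sum_def by (rule sum_mono2) (use c coeff_nonneg in auto)
  ultimately show ?thesis using d(4) by simp
qed

section \<open>Level sets of the potential and integration over levels\<close>

definition level_set :: "real \<Rightarrow> (nat \<times> nat) set" where
  "level_set t = {p \<in> pairsA m. potential L x (fst p) (snd p) < t \<and> t \<le> entry L x p}"

text \<open>If \<open>p\<close> strictly precedes \<open>q\<close>, the entry value at
  \<open>q\<close> is at most the potential at \<open>p\<close>. The half-open intervals of levels
  crossed at \<open>p\<close> and at \<open>q\<close> are therefore disjoint.\<close>

lemma antichain_level_set: "antichain (level_set t)"
  unfolding antichain_def
proof (intro ballI impI)
  fix p q assume p: "p \<in> level_set t" and q: "q \<in> level_set t" and le: "p \<preceq> q"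
  obtain i j i' j' where pq: "p = (i, j)" "q = (i', j')" by (metis surj_pair)
  have b: "1 \<le> i" "i < j" "1 \<le> i'" "i' < j'" "i \<le> i'" "j \<le> j'"
    using p q le by (auto simp: level_set_def pairsA_def pq pair_le_def)
  have t: "potential L x i j < t" "t \<le> entry L x (i', j')"
    using p q by (auto simp: level_set_def pq)
  show "p = q"
  proof (rule ccontr)
    assume "p \<noteq> q"
    then consider "i < i'" | "j < j'" "i = i'" using b pq by fastforce
    then show False
    proof cases
      case 1
      have "entry L x (i', j') \<le> potential L x (i' - 1) j'" using 1 b by (intro entry_le_above) auto
      also have "\<dots> \<le> potential L x i j" using 1 b by (intro potential_antimono) auto
      finally show False using t by simp
    next
      case 2
      have "entry L x (i', j') \<le> potential L x i' (j' - 1)" using 2 b by (intro entry_le_left) auto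
      also have "\<dots> \<le> potential L x i j" using 2 b by (intro potential_antimono) auto
      finally show False using t by simp
    qed
  qed
qed

lemma L_antimono: "k \<le> l \<Longrightarrow> L l \<le> L k"
  unfolding L by (rule sum_mono2) auto

text \<open>All levels crossed at \<open>(i, j)\<close> lie above \<open>L j\<close> and not above
  \<open>L i\<close>. A level between \<open>L (k + 1)\<close> and \<open>L k\<close> thus forces
  \<open>i \<le> k < j\<close>.\<close>

lemma level_set_subset_Q:
  assumes "L (k + 1) < t" "t \<le> L k"
  shows "level_set t \<subseteq> Q m k"
proof
  fix p assume p: "p \<in> level_set t"
  obtain i j where ij: "p = (i, j)" by (metis surj_pair)
  have b: "1 \<le> i" "i < j" "j \<le> m" "(i, j) \<in> pairsA m"
    using p ij by (auto simp: level_set_def pairsA_def)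
  have "t \<le> L i" using p entry_le_mark[OF b(1,2)] by (simp add: level_set_def ij)
  then have "i \<le> k" using assms L_antimono[of "k + 1" i] by (cases "i \<le> k") auto
  moreover have "L j < t" using p potential_ge_mark[OF b(4)] by (simp add: level_set_def ij)
  then have "k < j" using assms L_antimono[of j k] by (cases "k < j") auto
  ultimately show "p \<in> Q m k" using b by (simp add: Q_def ij)
qed

text \<open>The levels crossed at \<open>(i, j)\<close> lie between \<open>L j\<close> and
  \<open>L i\<close>, a range covered by the intervals between consecutive marks.\<close>

lemma level_set_empty:
  assumes "\<And>k. k \<in> {1..<m} \<Longrightarrow> \<not> (L (k + 1) < t \<and> t \<le> L k)"
  shows "level_set t = {}"
proof (rule ccontr)
  assume "level_set t \<noteq> {}"
  then obtain p where p: "p \<in> level_set t" by auto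
  obtain i j where ij: "p = (i, j)" by (metis surj_pair)
  have b: "1 \<le> i" "i < j" "j \<le> m" "(i, j) \<in> pairsA m"
    using p ij by (auto simp: level_set_def pairsA_def)
  have ti: "t \<le> L i" using p entry_le_mark[OF b(1,2)] by (simp add: level_set_def ij)
  have tj: "L j < t" using p potential_ge_mark[OF b(4)] by (simp add: level_set_def ij)
  have "t \<le> L l" if "i \<le> l" "l \<le> j" for l
    using that
  proof (induction l rule: dec_induct)
    case (step l)
    then show ?case using assms[of l] b by force
  qed (use ti in simp)
  from this[of j] show False using tj b by simp
qed

text \<open>Both sides are integrals over the level \<open>t\<close>. \<open>F t\<close> is the
  weight of the antichain \<open>level_set t\<close>, and \<open>G t\<close> equals
  \<open>M k\<close> on the interval of length \<open>b k\<close> between consecutive marks, so it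
  suffices to compare \<open>F\<close> and \<open>G\<close> pointwise.\<close>

lemma functional_le_antichain_bounds_aux:
  assumes w: "\<And>k A. k \<in> {1..<m} \<Longrightarrow> 0 < b k \<Longrightarrow> A \<subseteq> Q m k \<Longrightarrow> antichain A \<Longrightarrow> (\<Sum>p\<in>A. w p) \<le> M k"
  shows "(\<Sum>p\<in>pairsA m. w p * coeff_at x p) \<le> (\<Sum>k=1..<m. real (b k) * M k)"
proof -
  define F where "F t = (\<Sum>p\<in>pairsA m. w p * indicator {potential L x (fst p) (snd p)<..entry L x p} t)" for t
  define G where "G t = (\<Sum>k=1..<m. M k * indicator {L (k + 1)<..L k} t)" for t
  have step: "has_bochner_integral lborel (\<lambda>t. c * indicator {u<..v} t) (c * (v - u))"
    if "u \<le> v" for c u v :: real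
    using has_bochner_integral_real_indicator[of "{u<..v}" lborel] that
    by (intro has_bochner_integral_mult_right) auto
  have F: "has_bochner_integral lborel F (\<Sum>p\<in>pairsA m. w p * coeff_at x p)"
    unfolding F_def
  proof (rule has_bochner_integral_sum)
    fix p :: "nat \<times> nat"
    show "has_bochner_integral lborel
      (\<lambda>t. w p * indicator {potential L x (fst p) (snd p)<..entry L x p} t) (w p * coeff_at x p)"
      using step[of "potential L x (fst p) (snd p)" "entry L x p" "w p"]
        potential_le_entry[of "fst p" "snd p"] by (simp add: entry_def)
  qed
  have G: "has_bochner_integral lborel G (\<Sum>k=1..<m. real (b k) * M k)"
    unfolding G_def
  proof (rule has_bochner_integral_sum)
    fix k assume "k \<in> {1..<m}"
    then have "L k - L (k + 1) = real (b k)" by (simp add: L sum.atLeast_Suc_lessThan)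
    then show "has_bochner_integral lborel (\<lambda>t. M k * indicator {L (k + 1)<..L k} t) (real (b k) * M k)"
      using step[of "L (k + 1)" "L k" "M k"] by (simp add: mult.commute)
  qed
  have "F t \<le> G t" for t
  proof -
    have "F t = (\<Sum>p\<in>pairsA m. if p \<in> level_set t then w p else 0)"
      unfolding F_def by (rule sum.cong) (auto simp: level_set_def indicator_def)
    also have "\<dots> = (\<Sum>p\<in>pairsA m \<inter> level_set t. w p)"
      using finite_pairsA by (simp add: sum.inter_restrict)
    also have "pairsA m \<inter> level_set t = level_set t" by (auto simp: level_set_def)
    finally have Ft: "F t = (\<Sum>p\<in>level_set t. w p)" .
    show ?thesis
    proof (cases "\<exists>k\<in>{1..<m}. L (k + 1) < t \<and> t \<le> L k")
      case True
      then obtain k where k: "k \<in> {1..<m}" "L (k + 1) < t" "t \<le> L k" by auto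
      have "L k - L (k + 1) = real (b k)" using k(1) by (simp add: L sum.atLeast_Suc_lessThan)
      \<comment> \<open>An interval that contains a level has positive length, so the bounds
        \<open>M k\<close> are only required where \<open>b k\<close> is positive.\<close>
      then have "0 < b k" using k by (cases "b k = 0") auto
      then have "F t \<le> M k"
        unfolding Ft using k level_set_subset_Q antichain_level_set by (intro w) auto
      also have "M k = (\<Sum>l=1..<m. if l = k then M k else 0)" using k by simp
      also have "\<dots> = G t"
        unfolding G_def
      proof (rule sum.cong)
        fix l
        have "t \<notin> {L (l + 1)<..L l}" if "l \<noteq> k"
          using k that L_antimono[of "l + 1" k] L_antimono[of "k + 1" l]
          by (cases "l < k") auto
        then show "(if l = k then M k else 0) = M l * indicator {L (l + 1)<..L l} t"
          using k by (auto simp: indicator_def)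
      qed simp
      finally show ?thesis .
    next
      case False
      then have "level_set t = {}" by (intro level_set_empty) auto
      moreover have "G t = 0" unfolding G_def using False
        by (intro sum.neutral) (auto simp: indicator_def)
      ultimately show ?thesis by (simp add: Ft)
    qed
  qed
  then have "integral\<^sup>L lborel F \<le> integral\<^sup>L lborel G"
    using F G by (intro integral_mono) (auto simp: has_bochner_integral_iff)
  then show ?thesis using F G by (simp add: has_bochner_integral_integral_eq)
qed

end

text \<open>The Minkowski property of FFLV polytopes, in terms of support functions.\<close>

lemma functional_le_antichain_bounds:
  assumes "x \<in> FFLV_A m b"
    and "\<And>k A. k \<in> {1..<m} \<Longrightarrow> 0 < b k \<Longrightarrow> A \<subseteq> Q m k \<Longrightarrow> antichain A \<Longrightarrow> (\<Sum>p\<in>A. w p) \<le> M k"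
  shows "(\<Sum>p\<in>pairsA m. w p * coeff_at x p) \<le> (\<Sum>k=1..<m. real (b k) * M k)"
  using functional_le_antichain_bounds_aux[OF assms(1) refl, of w M] assms(2) by blast

section \<open>Vertices of the sum of two consecutive fundamental polytopes\<close>

lemma extreme_point_midpoint:
  assumes "x extreme_point_of S" "x + v \<in> S" "x - v \<in> S"
  shows "v = 0"
proof (rule ccontr)
  assume v: "v \<noteq> 0"
  have "x = midpoint (x + v) (x - v)"
    by (simp add: midpoint_def scaleR_2[symmetric])
  moreover have "x + v \<noteq> x - v"
  proof
    assume "x + v = x - v"
    then have "2 *\<^sub>R v = 0" by (simp add: scaleR_2 algebra_simps)
    then show False using v by simp
  qed
  ultimately have "x \<in> open_segment (x + v) (x - v)"
    by (metis midpoint_in_open_segment)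
  then show False using assms by (auto simp: extreme_point_of_def)
qed

text \<open>Let \<open>D\<close> be the set of all elements of \<open>B\<close> that violate the
  claim, and \<open>E\<close> the part of \<open>A\<close> above \<open>D\<close>. Moving
  \<open>D\<close> into the first antichain, or \<open>E\<close> into the second, gives two points
  of the polytope whose midpoint is \<open>chi A + chi B\<close>. For a vertex they coincide, and
  \<open>D\<close> is empty.\<close>

lemma chi_add_vertex_nested:
  assumes A: "A \<subseteq> Q m i" "antichain A" and B: "B \<subseteq> Q m (i + 1)" "antichain B"
    and ext: "(chi A + chi B) extreme_point_of FFLV_A m (\<lambda>k. omegaA i k + omegaA (i + 1) k)"
    and q: "q \<in> B"
  shows "fst q = i + 1 \<or> (\<exists>p\<in>A. p \<preceq> q)"
proof -
  define D where "D = {q \<in> B. fst q \<le> i \<and> (\<forall>p\<in>A. \<not> p \<preceq> q)}"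
  define E where "E = {p \<in> A. \<exists>q\<in>D. q \<preceq> p}"
  \<comment> \<open>Exchanging the two parts on which the order between \<open>A\<close> and \<open>B\<close> is reversed keeps the sum.\<close>
  define A' where "A' = D \<union> (A - E)"
  define B' where "B' = (B - D) \<union> E"
  have fA: "finite A" and fB: "finite B" using A B finite_Q finite_subset by blast+
  have DA: "D \<inter> A = {}" by (auto simp: D_def)
  have EB: "E \<inter> B = {}"
    using DA antichainD[OF B(2)] by (fastforce simp: E_def D_def)
  have DB: "D \<subseteq> B" and EA: "E \<subseteq> A" by (auto simp: D_def E_def)
  have "A' \<subseteq> Q m i" using A(1) B(1) EA by (fastforce simp: A'_def D_def Q_def)
  moreover have "antichain A'"
    using antichainD[OF A(2)] antichainD[OF B(2)]
    unfolding antichain_def A'_def E_def D_def by blast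
  ultimately have P1: "chi A' + chi B \<in> FFLV_A m (\<lambda>k. omegaA i k + omegaA (i + 1) k)"
    using B by (intro chi_add_in_FFLV_A)
  have "E \<subseteq> Q m (i + 1)"
  proof
    fix p assume "p \<in> E"
    then obtain q where "p \<in> A" "q \<in> B" "q \<preceq> p" by (auto simp: E_def D_def)
    then show "p \<in> Q m (i + 1)" using A(1) B(1) by (force simp: Q_def pair_le_def)
  qed
  then have "B' \<subseteq> Q m (i + 1)" using B(1) by (auto simp: B'_def)
  moreover have "antichain B'"
  proof -
    have "\<not> p \<preceq> q2 \<and> \<not> q2 \<preceq> p" if p: "p \<in> E" and q2: "q2 \<in> B - D" for p q2
    proof -
      obtain q where q: "q \<in> D" "q \<preceq> p" "p \<in> A" using p by (auto simp: E_def)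
      have "\<not> p \<preceq> q2"
        using q q2 pair_le_trans antichainD[OF B(2), of q q2] DB by blast
      moreover have "\<not> q2 \<preceq> p"
      proof
        assume le: "q2 \<preceq> p"
        have "fst p \<le> i" using q(3) A(1) by (auto simp: Q_def)
        then have "fst q2 \<le> i" using le by (simp add: pair_le_def)
        then obtain p' where p': "p' \<in> A" "p' \<preceq> q2" using q2 by (auto simp: D_def)
        then have "p' = p" using antichainD[OF A(2) p'(1) q(3)] pair_le_trans le by blast
        then have "p = q2" using p' le pair_le_antisym by blast
        then show False using p q2 EB by blast
      qed
      ultimately show ?thesis by blast
    qed
    then show ?thesis
      using antichainD[OF A(2)] antichainD[OF B(2)] EA unfolding antichain_def B'_def by blast
  qed
  ultimately have P2: "chi A + chi B' \<in> FFLV_A m (\<lambda>k. omegaA i k + omegaA (i + 1) k)"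
    using A by (intro chi_add_in_FFLV_A)
  have fin: "finite A'" "finite B'"
    using fA fB finite_subset[OF DB fB] finite_subset[OF EA fA] by (auto simp: A'_def B'_def)
  \<comment> \<open>Hence \<open>chi A' - chi A\<close> is the negative of
    \<open>chi B' - chi B\<close>, and the two one-sided exchanges lie symmetrically about the given
    point.\<close>
  have sum: "chi A' + chi B' = chi A + chi B"
  proof (rule poly_mapping_eqI)
    fix p
    show "coeff_at (chi A' + chi B') p = coeff_at (chi A + chi B) p"
      using fA fB fin DA EB DB EA
      by (auto simp: lookup_add lookup_chi indicator_def A'_def B'_def)
  qed
  have "(chi A + chi B) + (chi A' - chi A) = chi A' + chi B" by simp
  moreover have "(chi A + chi B) - (chi A' - chi A) = chi A + chi B'"
    using sum by (simp add: algebra_simps)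
  ultimately have "chi A' - chi A = 0"
    by (intro extreme_point_midpoint[OF ext]) (simp_all only: P1 P2)
  then have eq: "coeff_at (chi A') r = coeff_at (chi A) r" for r by simp
  have "D = {}"
  proof (rule ccontr)
    assume "D \<noteq> {}"
    then obtain r where r: "r \<in> D" by auto
    then have "coeff_at (chi A') r = 1" "coeff_at (chi A) r = 0"
      using fA fin DA by (auto simp: lookup_chi indicator_def A'_def)
    then show False using eq by simp
  qed
  moreover have "fst q \<le> i + 1" using q B by (auto simp: Q_def)
  moreover have "q \<in> D" if "fst q \<le> i" "\<not> (\<exists>p\<in>A. p \<preceq> q)"
    using that q by (simp add: D_def)
  ultimately show ?thesis by force
qed

text \<open>On a path that meets both antichains the two changes cancel, because its points satisfy
  \<open>p \<preceq> q\<close> and \<open>f p = f q\<close>. A path that meets only one of them has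
  bound 2, which leaves room for a change of size at most 1, unless the point met is next to the
  mark, where \<open>f\<close> vanishes.\<close>

lemma perturbed_chi_add_in_FFLV_A:
  assumes A: "A \<subseteq> Q m i" "antichain A" and B: "B \<subseteq> Q m (i + 1)" "antichain B"
    and nested: "\<And>q. q \<in> B \<Longrightarrow> fst q = i + 1 \<or> (\<exists>p\<in>A. p \<preceq> q)"
    and f: "\<And>p q. p \<in> A - B \<Longrightarrow> q \<in> B - A \<Longrightarrow> p \<preceq> q \<Longrightarrow> f p = f q"
      "\<And>p. p \<in> A - B \<Longrightarrow> snd p = i + 1 \<Longrightarrow> f p = 0"
      "\<And>q. q \<in> B - A \<Longrightarrow> fst q = i + 1 \<Longrightarrow> f q = 0"
    and f1: "\<And>p. \<bar>f p\<bar> \<le> (1::real)"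
    and v: "\<And>p. coeff_at v p = (if p \<in> A - B then f p else if p \<in> B - A then - f p else 0)"
  shows "chi A + chi B + v \<in> FFLV_A m (\<lambda>k. omegaA i k + omegaA (i + 1) k)"
proof -
  let ?x = "chi A + chi B + v"
  have fA: "finite A" and fB: "finite B" using A B finite_Q finite_subset by blast+
  \<comment> \<open>The coordinates are split into the share \<open>g\<close> of \<open>A\<close>
    and the share \<open>h\<close> of \<open>B\<close>; each share contributes at most one term to a
    path sum.\<close>
  define g where "g p = (if p \<in> A then 1 + (if p \<in> B then 0 else f p) else 0)" for p
  define h where "h p = (if p \<in> B then 1 - (if p \<in> A then 0 else f p) else 0)" for p
  have coeff: "coeff_at ?x p = g p + h p" for p
    using fA fB by (auto simp: lookup_add lookup_chi indicator_def v g_def h_def)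
  have "?x \<in> coord_space (pairsA m)"
  proof (rule coord_spaceI)
    fix p assume "p \<notin> pairsA m"
    then have "p \<notin> A" "p \<notin> B" using A(1) B(1) Q_subset_pairsA by blast+
    then show "coeff_at ?x p = 0" by (simp add: coeff g_def h_def)
  qed
  moreover have "0 \<le> coeff_at ?x p" for p
    using f1[of p] by (auto simp: coeff g_def h_def abs_le_iff)
  moreover have "path_sum ?x d \<le> real (boundA (\<lambda>k. omegaA i k + omegaA (i + 1) k) d)"
    if d: "dyck_pathA m d" for d
  proof -
    have sd: "successively dyck_step d" using d by (simp add: dyck_pathA_def)
    define r s where "r = fst (hd d)" and "s = fst (last d)"
    have rs: "r \<le> fst p" "snd p \<le> s + 1" if "p \<in> set d" for p
      using dyck_hd_le[OF sd that] dyck_le_last[OF sd that] d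
      by (auto simp: pair_le_def r_def s_def dyck_pathA_def)
    have "boundA (\<lambda>k. omegaA i k + omegaA (i + 1) k) d
        = (if i \<in> {r..s} then 1 else 0) + (if i + 1 \<in> {r..s} then 1 else 0)"
      by (simp add: boundA_def omegaA_def sum.distrib r_def s_def)
    then have bound: "real (boundA (\<lambda>k. omegaA i k + omegaA (i + 1) k) d)
        = (if i \<in> {r..s} then 1 else 0) + (if i + 1 \<in> {r..s} then 1 else 0)"
      by simp
    have sum: "path_sum ?x d = (\<Sum>p\<in>set d. g p) + (\<Sum>p\<in>set d. h p)"
      by (simp add: path_sum_def coeff sum.distrib)
    have gsum: "(\<Sum>p\<in>set d. g p) = g p" if "p \<in> set d" "p \<in> A" for p
    proof -
      have "q \<notin> A" if "q \<in> set d - {p}" for q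
        using that \<open>p \<in> set d\<close> \<open>p \<in> A\<close> dyck_meets_antichain_once[OF sd A(2)] by blast
      then have "(\<Sum>p\<in>set d. g p) = (\<Sum>p\<in>{p}. g p)"
        by (intro sum.mono_neutral_right) (use that in \<open>auto simp: g_def\<close>)
      then show ?thesis by simp
    qed
    have hsum: "(\<Sum>p\<in>set d. h p) = h p" if "p \<in> set d" "p \<in> B" for p
    proof -
      have "q \<notin> B" if "q \<in> set d - {p}" for q
        using that \<open>p \<in> set d\<close> \<open>p \<in> B\<close> dyck_meets_antichain_once[OF sd B(2)] by blast
      then have "(\<Sum>p\<in>set d. h p) = (\<Sum>p\<in>{p}. h p)"
        by (intro sum.mono_neutral_right) (use that in \<open>auto simp: h_def\<close>)
      then show ?thesis by simp
    qed
    have g0: "(\<Sum>p\<in>set d. g p) = 0" if "set d \<inter> A = {}"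
      using that by (intro sum.neutral) (auto simp: g_def)
    have h0: "(\<Sum>p\<in>set d. h p) = 0" if "set d \<inter> B = {}"
      using that by (intro sum.neutral) (auto simp: h_def)
    have inA: "i \<in> {r..s}" if "p \<in> set d" "p \<in> A" for p
      using rs[OF that(1)] that(2) A(1) by (force simp: Q_def)
    have inB: "i + 1 \<in> {r..s}" if "p \<in> set d" "p \<in> B" for p
      using rs[OF that(1)] that(2) B(1) by (force simp: Q_def)
    consider (none) "set d \<inter> A = {}" "set d \<inter> B = {}"
      | (A) p where "p \<in> set d" "p \<in> A" "set d \<inter> B = {}"
      | (B) q where "q \<in> set d" "q \<in> B" "set d \<inter> A = {}"
      | (AB) p q where "p \<in> set d" "p \<in> A" "q \<in> set d" "q \<in> B"
      by blast
    then show ?thesis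
    proof cases
      case none
      then show ?thesis by (simp add: sum g0 h0)
    next
      case (A p)
      have pB: "p \<notin> B" using A by auto
      have "path_sum ?x d = 1 + f p"
        unfolding sum gsum[OF A(1,2)] h0[OF A(3)] using A pB by (simp add: g_def)
      also have "\<dots> \<le> (if i \<in> {r..s} then 1 else 0) + (if i + 1 \<in> {r..s} then 1 else 0)"
      proof (cases "snd p = i + 1")
        case True
        then show ?thesis using f(2)[of p] A pB inA[of p] by simp
      next
        case False
        then have "i + 2 \<le> snd p" using A assms(1) by (force simp: Q_def)
        then have "i + 1 \<in> {r..s}" using rs[OF A(1)] inA[OF A(1,2)] by auto
        then show ?thesis using f1[of p] inA[OF A(1,2)] by simp
      qed
      finally show ?thesis using bound by simp
    next
      case (B q)
      have qA: "q \<notin> A" using B by auto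
      have "path_sum ?x d = 1 - f q"
        unfolding sum hsum[OF B(1,2)] g0[OF B(3)] using B qA by (simp add: h_def)
      also have "\<dots> \<le> (if i \<in> {r..s} then 1 else 0) + (if i + 1 \<in> {r..s} then 1 else 0)"
      proof (cases "fst q = i + 1")
        case True
        then show ?thesis using f(3)[of q] B qA inB[of q] by simp
      next
        case False
        then have "fst q \<le> i" using B assms(3) by (force simp: Q_def)
        then have "i \<in> {r..s}" using rs[OF B(1)] inB[OF B(1,2)] by auto
        then show ?thesis using f1[of q] inB[OF B(1,2)] by simp
      qed
      finally show ?thesis using bound by simp
    next
      case (AB p q)
      have "path_sum ?x d = g p + h q"
        unfolding sum gsum[OF AB(1,2)] hsum[OF AB(3,4)] ..
      also have "\<dots> = 2"
      proof (cases "p = q")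
        case True
        then show ?thesis using AB by (simp add: g_def h_def)
      next
        case False
        then have pB: "p \<notin> B" and qA: "q \<notin> A"
          using AB dyck_meets_antichain_once[OF sd] A(2) B(2) assms by blast+
        \<comment> \<open>Nesting fixes the orientation: below \<open>q\<close> there is an element
          of \<open>A\<close>, which would have to be \<open>p\<close> if \<open>q\<close> were
          below \<open>p\<close>.\<close>
        have "\<not> q \<preceq> p"
        proof
          assume le: "q \<preceq> p"
          have "fst p \<le> i" using AB assms(1) by (auto simp: Q_def)
          then have "fst q \<noteq> i + 1" using le by (simp add: pair_le_def)
          then obtain p' where p': "p' \<in> A" "p' \<preceq> q" using nested[OF AB(4)] by auto
          then have "p' = p"
            using antichainD[OF assms(2) p'(1) AB(2)] pair_le_trans le by blast
          then show False using p' le pair_le_antisym False by blast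
        qed
        then have "p \<preceq> q" using dyck_comparable[OF sd AB(1,3)] by blast
        then have "f p = f q" using f(1) AB pB qA by blast
        then show ?thesis using AB pB qA by (simp add: g_def h_def)
      qed
      finally show ?thesis using bound inA[OF AB(1,2)] inB[OF AB(3,4)] by simp
    qed
  qed
  ultimately show ?thesis by (simp add: FFLV_A_def)
qed

text \<open>After scaling, such an \<open>f\<close> gives a perturbation that can be both added to
  and subtracted from the point without leaving the polytope. At a vertex it must be zero.\<close>

lemma chi_add_vertex_rigid:
  fixes f :: "nat \<times> nat \<Rightarrow> real"
  assumes A: "A \<subseteq> Q m i" "antichain A" and B: "B \<subseteq> Q m (i + 1)" "antichain B"
    and ext: "(chi A + chi B) extreme_point_of FFLV_A m (\<lambda>k. omegaA i k + omegaA (i + 1) k)"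
    and f: "\<And>p q. p \<in> A - B \<Longrightarrow> q \<in> B - A \<Longrightarrow> p \<preceq> q \<Longrightarrow> f p = f q"
      "\<And>p. p \<in> A - B \<Longrightarrow> snd p = i + 1 \<Longrightarrow> f p = 0"
      "\<And>q. q \<in> B - A \<Longrightarrow> fst q = i + 1 \<Longrightarrow> f q = 0"
    and r: "r \<in> (A - B) \<union> (B - A)"
  shows "f r = 0"
proof -
  have fA: "finite A" and fB: "finite B" using A B finite_Q finite_subset by blast+
  \<comment> \<open>This bounds \<open>f\<close> on \<open>A \<union> B\<close>; the summand 1 keeps
    \<open>c\<close> positive when \<open>f\<close> vanishes there.\<close>
  define c where "c = 1 + (\<Sum>p\<in>A \<union> B. \<bar>f p\<bar>)"
  have c: "c > 0" unfolding c_def by (simp add: add_pos_nonneg sum_nonneg)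
  define g where "g p = (if p \<in> A \<union> B then f p / c else 0)" for p
  have "\<bar>f p\<bar> \<le> c" if "p \<in> A \<union> B" for p
    using member_le_sum[of p "A \<union> B" "\<lambda>p. \<bar>f p\<bar>"] that fA fB by (simp add: c_def)
  then have g1: "\<bar>g p\<bar> \<le> 1" for p using c by (auto simp: g_def)
  define v where "v = (\<Sum>p\<in>A - B. Poly_Mapping.single p (g p)) - (\<Sum>p\<in>B - A. Poly_Mapping.single p (g p))"
  have v: "coeff_at v p = (if p \<in> A - B then g p else if p \<in> B - A then - g p else 0)" for p
    using fA fB by (auto simp: v_def lookup_minus lookup_sum lookup_single when_def)
  note nested = chi_add_vertex_nested[OF A B ext]
  have gf: "g p = g q" if "p \<in> A - B" "q \<in> B - A" "p \<preceq> q" for p q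
    using f(1)[OF that] that by (simp add: g_def)
  have gA: "g p = 0" if "p \<in> A - B" "snd p = i + 1" for p
    using f(2)[OF that] by (simp add: g_def)
  have gB: "g q = 0" if "q \<in> B - A" "fst q = i + 1" for q
    using f(3)[OF that] by (simp add: g_def)
  have "chi A + chi B + v \<in> FFLV_A m (\<lambda>k. omegaA i k + omegaA (i + 1) k)"
    by (rule perturbed_chi_add_in_FFLV_A[OF A B nested gf gA gB g1 v])
  moreover have "chi A + chi B + (- v) \<in> FFLV_A m (\<lambda>k. omegaA i k + omegaA (i + 1) k)"
  proof (rule perturbed_chi_add_in_FFLV_A[OF A B nested, where f = "\<lambda>p. - g p"])
    show "coeff_at (- v) p = (if p \<in> A - B then - g p else if p \<in> B - A then - (- g p) else 0)" for p
      by (simp only: lookup_uminus v) simp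
    show "\<bar>- g p\<bar> \<le> 1" for p using g1[of p] by simp
    show "- g p = - g q" if "p \<in> A - B" "q \<in> B - A" "p \<preceq> q" for p q using gf[OF that] by simp
    show "- g p = 0" if "p \<in> A - B" "snd p = i + 1" for p using gA[OF that] by simp
    show "- g q = 0" if "q \<in> B - A" "fst q = i + 1" for q using gB[OF that] by simp
  qed
  ultimately have "v = 0"
    using extreme_point_midpoint[OF ext, of v] by simp
  then have "coeff_at v r = 0" by simp
  then have "g r = 0" using r by (auto simp: v split: if_splits)
  then show ?thesis using r c by (auto simp: g_def)
qed

section \<open>Compatible tuples of antichains give vertices\<close>

text \<open>The conditions on the tuple do not involve the weight \<open>a\<close>. The vertex
  condition is used only through its two consequences \<open>nested\<close> and
  \<open>rigid\<close>.\<close>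

locale compatible_antichains =
  fixes n :: nat and A :: "nat \<Rightarrow> (nat \<times> nat) set"
  assumes sub: "i \<in> {1..n} \<Longrightarrow> A i \<subseteq> QC n i"
    and anti: "i \<in> {1..n} \<Longrightarrow> antichain (A i)"
    and vertex: "i \<in> {1..<n} \<Longrightarrow> (chi (A i) + chi (A (i + 1))) extreme_point_of
          FFLV_A (2 * n) (\<lambda>k. omegaA i k + omegaA (i + 1) k)"
begin

lemma in_QC: "i \<in> {1..n} \<Longrightarrow> p \<in> A i \<Longrightarrow> p \<in> QC n i"
  using sub by blast

lemma nested:
  assumes "i \<in> {1..<n}" "q \<in> A (i + 1)"
  shows "fst q = i + 1 \<or> (\<exists>p\<in>A i. p \<preceq> q)"
proof (rule chi_add_vertex_nested)
  show "A i \<subseteq> Q (2 * n) i" "A (i + 1) \<subseteq> Q (2 * n) (i + 1)"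
    using sub[of i] sub[of "i + 1"] assms(1) QC_subset_Q by fastforce+
qed (use assms vertex anti in auto)

lemma rigid:
  fixes f :: "nat \<times> nat \<Rightarrow> real"
  assumes i: "i \<in> {1..<n}"
    and f: "\<And>p q. p \<in> A i - A (i + 1) \<Longrightarrow> q \<in> A (i + 1) - A i \<Longrightarrow> p \<preceq> q \<Longrightarrow> f p = f q"
      "\<And>p. p \<in> A i - A (i + 1) \<Longrightarrow> snd p = i + 1 \<Longrightarrow> f p = 0"
      "\<And>q. q \<in> A (i + 1) - A i \<Longrightarrow> fst q = i + 1 \<Longrightarrow> f q = 0"
    and r: "r \<in> (A i - A (i + 1)) \<union> (A (i + 1) - A i)"
  shows "f r = 0"
proof (rule chi_add_vertex_rigid)
  show "A i \<subseteq> Q (2 * n) i" "A (i + 1) \<subseteq> Q (2 * n) (i + 1)"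
    using sub[of i] sub[of "i + 1"] i QC_subset_Q by fastforce+
  show "antichain (A i)" "antichain (A (i + 1))"
    using anti[of i] anti[of "i + 1"] i by auto
qed (fact vertex[OF i] f r)+

text \<open>
  The two halves of a chain that selects one point of each \<open>A k\<close> for a range of \<open>k\<close>: \<open>upper i p S\<close>
  runs from a marked position \<open>(r, r)\<close> to \<open>p \<in> A i\<close>, and \<open>lower i p S\<close> from \<open>p \<in> A i\<close> to \<open>(s + 1, s + 1)\<close>
  or to the antidiagonal. The set \<open>S\<close> collects the selected points, including \<open>p\<close>.
\<close>

inductive upper :: "nat \<Rightarrow> nat \<times> nat \<Rightarrow> (nat \<times> nat) set \<Rightarrow> bool" where
  upper_start: "i \<in> {1..n} \<Longrightarrow> p \<in> A i \<Longrightarrow> fst p = i \<or> i = 1 \<Longrightarrow> upper i p {p}"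
| upper_step: "upper i q S \<Longrightarrow> i \<in> {1..<n} \<Longrightarrow> p \<in> A (i + 1) \<Longrightarrow> q \<preceq> p \<Longrightarrow> upper (i + 1) p (insert p S)"

inductive lower :: "nat \<Rightarrow> nat \<times> nat \<Rightarrow> (nat \<times> nat) set \<Rightarrow> bool" where
  lower_end: "i \<in> {1..n} \<Longrightarrow> p \<in> A i \<Longrightarrow> snd p = i + 1 \<or> i = n \<Longrightarrow> lower i p {p}"
| lower_step: "lower (i + 1) q S \<Longrightarrow> i \<in> {1..<n} \<Longrightarrow> p \<in> A i \<Longrightarrow> p \<preceq> q \<Longrightarrow> lower i p (insert p S)"

text \<open>By \<open>nested\<close>, a point that cannot start a chain has an element of the
  previous antichain below it.\<close>

lemma upper_exists:
  assumes "i \<in> {1..n}" "p \<in> A i"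
  shows "\<exists>S. upper i p S"
  using assms
proof (induction i arbitrary: p)
  case (Suc i)
  show ?case
  proof (cases "fst p = Suc i \<or> Suc i = 1")
    case True
    then show ?thesis using upper_start[of "Suc i" p] Suc.prems by auto
  next
    case False
    then obtain q where q: "q \<in> A i" "q \<preceq> p" using nested[of i p] Suc.prems by auto
    moreover have "i \<in> {1..n}" using Suc.prems False by auto
    ultimately obtain S where "upper i q S" using Suc.IH by blast
    then show ?thesis using upper_step[of i q S p] q Suc.prems False by fastforce
  qed
qed simp

text \<open>The counterpart of \<open>nested\<close> in the other direction comes from rigidity. A
  point of \<open>A i\<close> outside \<open>A (i + 1)\<close> that neither ends a chain nor lies
  below an element of \<open>A (i + 1)\<close> would admit the function that is 1 there and 0
  elsewhere.\<close>

lemma lower_exists: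
  assumes "i \<in> {1..n}" "p \<in> A i"
  shows "\<exists>S. lower i p S"
proof -
  have "i \<le> n" using assms by simp
  then show ?thesis using assms
  proof (induction i arbitrary: p rule: inc_induct)
    case base
    then show ?case using lower_end by blast
  next
    case (step i)
    have i: "i \<in> {1..<n}" using step by auto
    show ?case
    proof (cases "snd p = i + 1 \<or> p \<in> A (i + 1)")
      case True
      then show ?thesis
      proof
        assume "snd p = i + 1"
        then show ?thesis using lower_end[of i p] step.prems by auto
      next
        assume "p \<in> A (i + 1)"
        then obtain S where "lower (i + 1) p S" using step.IH[of p] i by auto
        then show ?thesis using lower_step[of i p S p] i step.prems by auto
      qed
    next
      case False
      have "\<exists>q\<in>A (i + 1). p \<preceq> q"
      proof (rule ccontr)
        assume "\<not> ?thesis"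
        then have "(if p = p then 1 else 0 :: real) = 0"
          using step.prems False
          by (intro rigid[OF i, of "\<lambda>r. if r = p then 1 else 0" p]) auto
        then show False by simp
      qed
      then obtain q where q: "q \<in> A (i + 1)" "p \<preceq> q" by auto
      then obtain S where "lower (i + 1) q S" using step.IH[of q] i by auto
      then show ?thesis using lower_step[of i q S p] i step.prems q by auto
    qed
  qed
qed

text \<open>Consecutive selected points are joined by lattice paths. That \<open>S\<close> meets
  every \<open>A k\<close> from the starting mark \<open>r\<close> up to \<open>i\<close> is what
  makes the completed path tight.\<close>

lemma upper_path:
  assumes "upper i p S"
  shows "\<exists>r d. 1 \<le> r \<and> r \<le> i \<and> lattice_path (pairsC n) (r, r + 1) p d \<and> S \<subseteq> set d \<and> finite S \<and>
    (\<forall>q\<in>S. q \<preceq> p) \<and> p \<in> S \<and> i \<in> {1..n} \<and> p \<in> A i \<and> (\<forall>k\<in>{r..i}. A k \<inter> S \<noteq> {})"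
  using assms
proof induction
  case (upper_start i p)
  then have p: "p \<in> QC n i" by (intro in_QC)
  then have i: "fst p = i" using upper_start by (auto simp: QC_def Q_def)
  obtain d where d: "lattice_path (pairsC n) (i, i + 1) p d"
    using lattice_path_pairsC[of "(i, i + 1)" n p] p i upper_start
    by (auto simp: QC_def Q_def pairsC_def pair_le_def)
  then have "p \<in> set d" by (auto simp: lattice_path_def)
  then show ?case using d upper_start i by (intro exI[of _ i] exI[of _ d]) auto
next
  case (upper_step i q S p)
  then obtain r d where d: "1 \<le> r" "r \<le> i" "lattice_path (pairsC n) (r, r + 1) q d" "S \<subseteq> set d"
    "finite S" "\<forall>q'\<in>S. q' \<preceq> q" "i \<in> {1..n}" "q \<in> A i" "\<forall>k\<in>{r..i}. A k \<inter> S \<noteq> {}" by auto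
  have "q \<in> pairsC n" "p \<in> pairsC n"
    using d(7,8) upper_step.hyps in_QC[of i q] in_QC[of "i + 1" p] QC_subset_pairsC by auto
  then obtain e where e: "lattice_path (pairsC n) q p e"
    using lattice_path_pairsC upper_step.hyps by blast
  have c: "lattice_path (pairsC n) (r, r + 1) p (d @ tl e)" "set (d @ tl e) = set d \<union> set e"
    using lattice_path_append[OF d(3) e] by auto
  have "p \<in> set e" using e by (auto simp: lattice_path_def)
  moreover have "\<forall>k\<in>{r..i+1}. A k \<inter> insert p S \<noteq> {}"
    using d(9) upper_step.hyps by (auto simp: le_Suc_eq)
  moreover have "\<forall>q'\<in>insert p S. q' \<preceq> p"
    using d(6) upper_step.hyps pair_le_trans pair_le_refl by blast
  ultimately show ?case using d c upper_step.hyps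
    by (intro exI[of _ r] exI[of _ "d @ tl e"]) auto
qed

lemma lower_path:
  assumes "lower i p S"
  shows "\<exists>s z d. i \<le> s \<and> s \<le> n \<and> lattice_path (pairsC n) p z d \<and>
    (z = (s, s + 1) \<or> s = n \<and> fst z + snd z = 2 * n + 1) \<and> S \<subseteq> set d \<and> finite S \<and>
    (\<forall>q\<in>S. p \<preceq> q) \<and> p \<in> S \<and> i \<in> {1..n} \<and> p \<in> A i \<and> (\<forall>k\<in>{i..s}. A k \<inter> S \<noteq> {})"
  using assms
proof induction
  case (lower_end i p)
  then have p: "p \<in> QC n i" by (intro in_QC)
  \<comment> \<open>If \<open>p\<close> is not in column \<open>i + 1\<close>, then
    \<open>i = n\<close>, and the path goes from \<open>p\<close> to the antidiagonal with its first
    coordinate fixed.\<close>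
  define z where "z = (if snd p = i + 1 then (i, i + 1) else (fst p, 2 * n + 1 - fst p))"
  have "z \<in> pairsC n" "p \<in> pairsC n" "p \<preceq> z"
    using p lower_end by (auto simp: z_def QC_def Q_def pairsC_def pair_le_def)
  then obtain d where d: "lattice_path (pairsC n) p z d"
    using lattice_path_pairsC by blast
  then have "p \<in> set d" by (auto simp: lattice_path_def)
  moreover have "z = (i, i + 1) \<or> i = n \<and> fst z + snd z = 2 * n + 1"
    using lower_end p by (auto simp: z_def QC_def Q_def)
  ultimately show ?case using d lower_end by (intro exI[of _ i] exI[of _ z] exI[of _ d]) auto
next
  case (lower_step i q S p)
  then obtain s z d where d: "i + 1 \<le> s" "s \<le> n" "lattice_path (pairsC n) q z d"
    "z = (s, s + 1) \<or> s = n \<and> fst z + snd z = 2 * n + 1" "S \<subseteq> set d"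
    "finite S" "\<forall>q'\<in>S. q \<preceq> q'" "q \<in> A (i + 1)" "\<forall>k\<in>{i+1..s}. A k \<inter> S \<noteq> {}"
    by auto
  have "q \<in> pairsC n" "p \<in> pairsC n"
    using d(8) lower_step.hyps in_QC[of i p] in_QC[of "i + 1" q] QC_subset_pairsC by auto
  then obtain e where e: "lattice_path (pairsC n) p q e"
    using lattice_path_pairsC lower_step.hyps by blast
  have c: "lattice_path (pairsC n) p z (e @ tl d)" "set (e @ tl d) = set e \<union> set d"
    using lattice_path_append[OF e d(3)] by auto
  have "p \<in> set e" using e by (auto simp: lattice_path_def)
  moreover have "A k \<inter> insert p S \<noteq> {}" if "k \<in> {i..s}" for k
    using d(9) lower_step.hyps that by (cases "k = i") auto
  moreover have "\<forall>q'\<in>insert p S. p \<preceq> q'"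
    using d(7) lower_step.hyps pair_le_trans pair_le_refl by blast
  ultimately show ?case using d c lower_step.hyps
    by (intro exI[of _ s] exI[of _ z] exI[of _ "e @ tl d"]) auto
qed

text \<open>Here \<open>v\<close> is a direction supported on the union of the antichains that keeps
  tight chains tight. The inner quantification over \<open>a\<close> in \<open>tight\<close>
  expresses that \<open>r..s\<close> is the index range of the bound of \<open>d\<close> for every
  weight.\<close>

context
  fixes v :: "nat \<times> nat \<Rightarrow> real"
  assumes supp: "v p \<noteq> 0 \<Longrightarrow> \<exists>k\<in>{1..n}. p \<in> A k"
    and tight: "\<And>d r s. dyck_pathC n d \<Longrightarrow> (\<And>a. boundC n a d = (\<Sum>k=r..s. a k)) \<Longrightarrow> 1 \<le> r \<Longrightarrow> s \<le> n \<Longrightarrow>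
      (\<forall>k\<in>{r..s}. set d \<inter> A k \<noteq> {}) \<Longrightarrow> (\<Sum>p\<in>set d. v p) = 0"
begin

text \<open>The two halves join to a tight path, so \<open>v\<close> sums to zero along it. A point
  of the path outside \<open>S \<union> T\<close> with nonzero \<open>v\<close> would lie in some
  \<open>A k\<close> that the path already meets in \<open>S \<union> T\<close>. The halves share
  exactly \<open>p\<close>, so \<open>v p\<close> is counted twice.\<close>

lemma upper_lower_sum:
  assumes "upper i p S" "lower i p T"
  shows "(\<Sum>q\<in>S. v q) + (\<Sum>q\<in>T. v q) = v p"
proof -
  obtain r d where d: "1 \<le> r" "r \<le> i" "lattice_path (pairsC n) (r, r + 1) p d" "S \<subseteq> set d"
    "finite S" "\<forall>q\<in>S. q \<preceq> p" "p \<in> S" "\<forall>k\<in>{r..i}. A k \<inter> S \<noteq> {}"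
    using upper_path[OF assms(1)] by blast
  obtain s z e where e: "i \<le> s" "s \<le> n" "lattice_path (pairsC n) p z e"
    "z = (s, s + 1) \<or> s = n \<and> fst z + snd z = 2 * n + 1" "T \<subseteq> set e"
    "finite T" "\<forall>q\<in>T. p \<preceq> q" "p \<in> T" "\<forall>k\<in>{i..s}. A k \<inter> T \<noteq> {}"
    using lower_path[OF assms(2)] by blast
  define c where "c = d @ tl e"
  have c: "lattice_path (pairsC n) (r, r + 1) z c" "set c = set d \<union> set e"
    using lattice_path_append[OF d(3) e(3)] by (auto simp: c_def)
  have sc: "successively dyck_step c" and hd: "hd c = (r, r + 1)" and last: "last c = z"
    using c by (auto simp: lattice_path_def)
  have dyck: "dyck_pathC n c"
    using c(1) e(4) by (auto simp: lattice_path_def dyck_pathC_def)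
  have meet: "A k \<inter> (S \<union> T) \<noteq> {}" if "k \<in> {r..s}" for k
    using d(8) e(9) that by (cases "k \<le> i") auto
  have "(\<Sum>q\<in>set c. v q) = 0"
  proof (rule tight[OF dyck, of r s])
    show "boundC n a c = (\<Sum>k=r..s. a k)" for a
    proof -
      have "s = (if snd z = fst z + 1 then fst z else n)" using e(4) by auto
      then show ?thesis using hd last by (simp add: boundC_def)
    qed
    show "\<forall>k\<in>{r..s}. set c \<inter> A k \<noteq> {}"
      using meet c(2) d(4) e(5) by blast
  qed (use d e in auto)
  moreover have "(\<Sum>q\<in>set c. v q) = (\<Sum>q\<in>S \<union> T. v q)"
  proof (rule sum.mono_neutral_right)
    show "S \<union> T \<subseteq> set c" using c(2) d(4) e(5) by blast
    show "\<forall>q\<in>set c - (S \<union> T). v q = 0"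
    proof (rule ballI, rule ccontr)
      fix q assume q: "q \<in> set c - (S \<union> T)" "v q \<noteq> 0"
      then obtain k where k: "k \<in> {1..n}" "q \<in> A k" using supp by blast
      have "(r, r + 1) \<preceq> q" "q \<preceq> z" using dyck_hd_le[OF sc] dyck_le_last[OF sc] q hd last by auto
      moreover have "q \<in> QC n k" using in_QC k by blast
      ultimately have "k \<in> {r..s}"
        using e(4) k by (auto simp: pair_le_def QC_def Q_def)
      then obtain q' where q': "q' \<in> A k" "q' \<in> S \<union> T" using meet by blast
      then have "q' = q"
        using dyck_meets_antichain_once[OF sc anti[OF k(1)]] q k c(2) d(4) e(5) by blast
      then show False using q q' by blast
    qed
  qed simp
  moreover have "S \<inter> T = {p}"
    using d(6,7) e(7,8) pair_le_antisym by blast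
  ultimately show ?thesis using sum.union_inter[OF d(5) e(6), of v] by simp
qed

section \<open>Sums over lower halves of tight chains\<close>

definition lower_sum :: "nat \<Rightarrow> nat \<times> nat \<Rightarrow> real" where
  "lower_sum i p = (\<Sum>q\<in>(SOME T. lower i p T). v q)"

text \<open>Compared with one fixed upper half at \<open>p\<close>, all lower halves have the same
  sum, so the choice in \<open>lower_sum\<close> does not matter.\<close>

lemma lower_sum_eq:
  assumes "lower i p T"
  shows "lower_sum i p = (\<Sum>q\<in>T. v q)"
proof -
  have "i \<in> {1..n}" "p \<in> A i" using lower_path[OF assms] by auto
  then obtain S where S: "upper i p S" using upper_exists by blast
  have "lower i p (SOME T. lower i p T)" using assms by (rule someI)
  from upper_lower_sum[OF S this] upper_lower_sum[OF S assms] show ?thesis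
    by (simp add: lower_sum_def)
qed

lemma lower_sum_step:
  assumes i: "i \<in> {1..<n}" and p: "p \<in> A i" and q: "q \<in> A (i + 1)" and le: "p \<preceq> q"
  shows "lower_sum i p = (if p = q then 0 else v p) + lower_sum (i + 1) q"
proof -
  obtain T where T: "lower (i + 1) q T" using lower_exists[of "i + 1" q] q i by auto
  have "lower i p (insert p T)" using lower_step[OF T i p le] .
  then have "lower_sum i p = (\<Sum>q\<in>insert p T. v q)" by (rule lower_sum_eq)
  moreover have fin: "finite T" "q \<in> T" "\<forall>q'\<in>T. q \<preceq> q'" using lower_path[OF T] by auto
  moreover have "p \<notin> T" if "p \<noteq> q" using fin le that pair_le_antisym by blast
  ultimately show ?thesis using lower_sum_eq[OF T] by (simp add: insert_absorb)
qed

lemma lower_sum_end: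
  assumes "i \<in> {1..n}" "p \<in> A i" "snd p = i + 1 \<or> i = n"
  shows "lower_sum i p = v p"
  using lower_sum_eq[OF lower_end[OF assms]] by simp

lemma lower_sum_start:
  assumes "i \<in> {1..n}" "p \<in> A i" "fst p = i \<or> i = 1"
  shows "lower_sum i p = 0"
proof -
  obtain T where T: "lower i p T" using lower_exists assms by blast
  show ?thesis using upper_lower_sum[OF upper_start[OF assms] T] lower_sum_eq[OF T] by simp
qed

text \<open>The function \<open>f\<close> meets the hypotheses of \<open>rigid\<close>:
  \<open>lower_sum_step\<close> makes it constant along relations, while
  \<open>lower_sum_end\<close> and \<open>lower_sum_start\<close> give the zeros next to the mark.
  Hence it vanishes on the symmetric difference.\<close>

lemma lower_sum_leave_enter:
  assumes i: "i \<in> {1..<n}"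
  shows "p \<in> A i - A (i + 1) \<Longrightarrow> lower_sum i p = v p"
    and "p \<in> A (i + 1) - A i \<Longrightarrow> lower_sum (i + 1) p = 0"
proof -
  define f where "f p = (if p \<in> A i then lower_sum i p - v p else lower_sum (i + 1) p)" for p
  have f0: "f r = 0" if "r \<in> (A i - A (i + 1)) \<union> (A (i + 1) - A i)" for r
  proof (rule rigid[OF i _ _ _ that])
    fix p q assume "p \<in> A i - A (i + 1)" "q \<in> A (i + 1) - A i" "p \<preceq> q"
    then show "f p = f q" using lower_sum_step[OF i, of p q] by (auto simp: f_def)
  next
    fix p assume "p \<in> A i - A (i + 1)" "snd p = i + 1"
    then show "f p = 0" using lower_sum_end[of i p] i by (auto simp: f_def)
  next
    fix q assume "q \<in> A (i + 1) - A i" "fst q = i + 1"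
    then show "f q = 0" using lower_sum_start[of "i + 1" q] i by (auto simp: f_def)
  qed
  show "p \<in> A i - A (i + 1) \<Longrightarrow> lower_sum i p = v p" using f0[of p] by (auto simp: f_def)
  show "p \<in> A (i + 1) - A i \<Longrightarrow> lower_sum (i + 1) p = 0" using f0[of p] by (auto simp: f_def)
qed

text \<open>Induction from the first antichain upwards: a point that stays keeps its value by
  \<open>lower_sum_step\<close> with equal points, and a point that enters has value zero.\<close>

lemma lower_sum_zero: "i \<in> {1..n} \<Longrightarrow> p \<in> A i \<Longrightarrow> lower_sum i p = 0"
proof (induction i)
  case (Suc i)
  show ?case
  proof (cases "i = 0")
    case True
    then show ?thesis using lower_sum_start[of "Suc i" p] Suc.prems by auto
  next
    case False
    then have i: "i \<in> {1..<n}" using Suc.prems by auto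
    show ?thesis
    proof (cases "p \<in> A i")
      case True
      then show ?thesis using lower_sum_step[OF i True, of p] Suc i by auto
    next
      case False
      then show ?thesis using lower_sum_leave_enter(2)[OF i, of p] Suc.prems by auto
    qed
  qed
qed simp

text \<open>The mirror image of \<open>lower_sum_zero\<close>: induction from \<open>n\<close>
  downwards, where a point that leaves has value \<open>v p\<close>. Together the two lemmas force
  \<open>v = 0\<close>.\<close>

lemma lower_sum_value:
  assumes "i \<in> {1..n}" "p \<in> A i"
  shows "lower_sum i p = v p"
proof -
  have "i \<le> n" using assms by simp
  then show ?thesis using assms
  proof (induction i rule: inc_induct)
    case base
    then show ?case using lower_sum_end by blast
  next
    case (step i)
    then have i: "i \<in> {1..<n}" by auto
    show ?case
    proof (cases "p \<in> A (i + 1)")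
      case True
      then show ?thesis using lower_sum_step[OF i _ True, of p] step i by auto
    next
      case False
      then show ?thesis using lower_sum_leave_enter(1)[OF i, of p] step.prems by auto
    qed
  qed
qed

lemma tight_direction_zero: "v p = 0"
proof (rule ccontr)
  assume "v p \<noteq> 0"
  then obtain k where "k \<in> {1..n}" "p \<in> A k" using supp by blast
  then show False using lower_sum_zero lower_sum_value \<open>v p \<noteq> 0\<close> by simp
qed

end

text \<open>If the point is inside a segment from \<open>y\<close> to \<open>z\<close>, every
  inequality that is tight at it is tight at both ends. So \<open>z - y\<close> is a direction of
  the kind treated above and vanishes.\<close>

lemma extreme_point_sum_chi:
  "(\<Sum>i=1..n. real (a i) *\<^sub>R chi (A i)) extreme_point_of FFLV_C n a"
proof -
  let ?x = "\<Sum>i=1..n. real (a i) *\<^sub>R chi (A i)"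
  have fin: "finite (A i)" if "i \<in> {1..n}" for i
    using sub[OF that] finite_QC finite_subset by blast
  have coeff: "coeff_at ?x p = (\<Sum>i=1..n. real (a i) * indicator (A i) p)" for p
    using fin by (rule coeff_sum_chi)
  have False if y: "y \<in> FFLV_C n a" and z: "z \<in> FFLV_C n a" and seg: "?x \<in> open_segment y z" for y z
  proof -
    obtain u where u: "0 < u" "u < 1" "?x = (1 - u) *\<^sub>R y + u *\<^sub>R z" and yz: "y \<noteq> z"
      using seg by (auto simp: in_segment)
    have nonneg: "0 \<le> coeff_at y p" "0 \<le> coeff_at z p" for p
      using y z coeff_zero_outside[of y "pairsC n" p] coeff_zero_outside[of z "pairsC n" p]
      by (cases "p \<in> pairsC n"; auto simp: FFLV_C_def)+
    have "coeff_at z p - coeff_at y p = 0" for p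
    proof (rule tight_direction_zero[where v = "\<lambda>p. coeff_at z p - coeff_at y p"])
      fix p assume ne: "coeff_at z p - coeff_at y p \<noteq> 0"
      show "\<exists>k\<in>{1..n}. p \<in> A k"
      proof (rule ccontr)
        assume "\<not> ?thesis"
        then have "coeff_at ?x p = 0" unfolding coeff by (intro sum.neutral) auto
        then have "(1 - u) * coeff_at y p + u * coeff_at z p = 0"
          by (simp only: u(3) lookup_add lookup_scaleR)
        moreover have "0 \<le> (1 - u) * coeff_at y p" "0 \<le> u * coeff_at z p"
          using u nonneg by auto
        ultimately have "(1 - u) * coeff_at y p = 0" "u * coeff_at z p = 0" by linarith+
        then show False using u ne by simp
      qed
    next
      fix d r s assume d: "dyck_pathC n d" and bd: "\<And>a. boundC n a d = (\<Sum>k=r..s. a k)"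
        and rs: "1 \<le> r" "s \<le> n" and meet: "\<forall>k\<in>{r..s}. set d \<inter> A k \<noteq> {}"
      have sd: "successively dyck_step d" using d by (simp add: dyck_pathC_def)
      \<comment> \<open>A path that meets every antichain of its range collects the full bound;
        antichains outside the range can only add to it.\<close>
      have "real (boundC n a d) = (\<Sum>k=r..s. real (a k))" by (simp add: bd)
      also have "\<dots> = (\<Sum>k=r..s. if set d \<inter> A k = {} then 0 else real (a k))"
        using meet by (intro sum.cong) auto
      also have "\<dots> \<le> (\<Sum>k=1..n. if set d \<inter> A k = {} then 0 else real (a k))"
        using rs by (intro sum_mono2) auto
      also have "\<dots> = path_sum ?x d"
        using path_sum_sum_chi[OF sd, of "{1..n}" A "\<lambda>i. real (a i)"] anti fin by simp
      also have "\<dots> = (1 - u) * path_sum y d + u * path_sum z d"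
        by (simp only: u(3) path_sum_add path_sum_scaleR)
      finally have ge: "real (boundC n a d) \<le> (1 - u) * path_sum y d + u * path_sum z d" .
      have le: "path_sum y d \<le> real (boundC n a d)" "path_sum z d \<le> real (boundC n a d)"
        using y z d by (auto simp: FFLV_C_def)
      have "0 \<le> (1 - u) * (real (boundC n a d) - path_sum y d)" "0 \<le> u * (real (boundC n a d) - path_sum z d)"
        using le u by auto
      moreover have "(1 - u) * (real (boundC n a d) - path_sum y d) + u * (real (boundC n a d) - path_sum z d) \<le> 0"
        using ge by (simp add: algebra_simps)
      ultimately have "(1 - u) * (real (boundC n a d) - path_sum y d) = 0"
        "u * (real (boundC n a d) - path_sum z d) = 0" by linarith+
      then have "path_sum y d = path_sum z d" using u by simp
      then show "(\<Sum>p\<in>set d. coeff_at z p - coeff_at y p) = 0"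
        by (simp add: path_sum_def sum_subtractf)
    qed
    then have "y = z" by (intro poly_mapping_eqI) simp
    then show False using yz by simp
  qed
  moreover have "?x \<in> FFLV_C n a" using sub anti by (rule sum_chi_in_FFLV_C)
  ultimately show ?thesis by (auto simp: extreme_point_of_def)
qed

end

section \<open>Vertices are sums of antichains\<close>

text \<open>A type A path that crosses the antidiagonal never returns, and \<open>x\<close> vanishes
  beyond it. The part before the crossing is a type C path, and the zero coefficients after
  \<open>n\<close> make the two bounds agree.\<close>

lemma FFLV_C_subset_FFLV_A: "FFLV_C n a \<subseteq> FFLV_A (2 * n) (\<lambda>k. if k \<le> n then a k else 0)"
proof
  fix x assume x: "x \<in> FFLV_C n a"
  let ?b = "\<lambda>k. if k \<le> n then a k else 0"
  have xC: "x \<in> coord_space (pairsC n)" using x by (simp add: FFLV_C_def)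
  have outside: "coeff_at x p = 0" if "p \<notin> pairsC n" for p
    using coeff_zero_outside[OF xC that] .
  have "x \<in> coord_space (pairsA (2 * n))"
    using xC pairsC_subset_pairsA by (force simp: coord_space_def)
  moreover have "0 \<le> coeff_at x p" for p
    using x outside[of p] by (cases "p \<in> pairsC n") (auto simp: FFLV_C_def)
  moreover have "path_sum x d \<le> real (boundA ?b d)" if d: "dyck_pathA (2 * n) d" for d
  proof -
    have sd: "successively dyck_step d" and dne: "d \<noteq> []" using d by (auto simp: dyck_pathA_def)
    define P where "P = (\<lambda>p :: nat \<times> nat. fst p + snd p \<le> 2 * n + 1)"
    define c e where "c = takeWhile P d" and "e = dropWhile P d"
    have dce: "d = c @ e" by (simp add: c_def e_def)
    have sc: "successively dyck_step c" and se: "successively dyck_step e"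
      using sd by (auto simp: dce successively_append_iff)
    have e0: "coeff_at x p = 0" if "p \<in> set e" for p
    proof -
      have "\<not> P (hd e)" using that hd_dropWhile[of P d] unfolding e_def by fastforce
      moreover have "hd e \<preceq> p" using dyck_hd_le[OF se that] .
      ultimately have "p \<notin> pairsC n" by (auto simp: P_def pairsC_def pair_le_def)
      then show ?thesis by (rule outside)
    qed
    have "path_sum x d = path_sum x c"
      unfolding path_sum_def by (rule sum.mono_neutral_right) (use e0 in \<open>auto simp: dce\<close>)
    also have "\<dots> \<le> real (boundA ?b d)"
    proof (cases "c = []")
      case True
      then show ?thesis by (simp add: path_sum_def)
    next
      case False
      have hd: "hd c = hd d" using False by (simp add: dce)
      have setc: "set c \<subseteq> pairsC n"
      proof
        fix p assume p: "p \<in> set c"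
        then have "P p" unfolding c_def by (rule set_takeWhileD[THEN conjunct2])
        moreover have "p \<in> pairsA (2 * n)" using p d by (auto simp: dce dyck_pathA_def)
        ultimately show "p \<in> pairsC n" by (auto simp: P_def pairsA_def pairsC_def)
      qed
      have lastC: "last c \<in> pairsC n" using setc False by auto
      have hd1: "snd (hd d) = fst (hd d) + 1" and last1: "snd (last d) = fst (last d) + 1"
        using d by (auto simp: dyck_pathA_def)
      have "dyck_pathC n c \<and> boundC n a c \<le> boundA ?b d"
      proof (cases "e = []")
        case True
        then have cd: "c = d" by (simp add: dce)
        then have "fst (last d) \<le> n" using lastC last1 by (auto simp: pairsC_def)
        then have "boundA ?b d = boundC n a c"
          using last1 cd by (auto simp: boundA_def boundC_def intro!: sum.cong)
        then show ?thesis using cd setc sc hd hd1 last1 False by (simp add: dyck_pathC_def)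
      next
        case e: False
        have "\<not> P (hd e)" using hd_dropWhile[of P d] e by (simp add: e_def)
        moreover have "dyck_step (last c) (hd e)"
          using sd False e by (auto simp: dce successively_append_iff)
        ultimately have sum: "fst (last c) + snd (last c) = 2 * n + 1"
          using lastC by (auto simp: P_def dyck_step_def pairsC_def)
        have "hd e \<preceq> last d" using dyck_le_last[OF sd, of "hd e"] e by (simp add: dce)
        then have "n \<le> fst (last d)"
          using \<open>\<not> P (hd e)\<close> last1 by (auto simp: P_def pair_le_def)
        then have "boundA ?b d = (\<Sum>k\<in>{fst (hd d)..n}. a k)"
          unfolding boundA_def by (intro sum.mono_neutral_cong_right) auto
        moreover have "boundC n a c = (\<Sum>k\<in>{fst (hd d)..n}. a k)"
        proof -
          \<comment> \<open>The two kinds of endings overlap only in \<open>(n, n + 1)\<close>,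
            where both clauses of \<open>boundC\<close> give the same sum.\<close>
          have "fst (last c) = n" if "snd (last c) = fst (last c) + 1" using sum that by simp
          then show ?thesis by (simp add: boundC_def hd)
        qed
        ultimately show ?thesis using setc sc hd hd1 sum False by (simp add: dyck_pathC_def)
      qed
      moreover from this have "path_sum x c \<le> real (boundC n a c)" using x by (simp add: FFLV_C_def)
      ultimately show ?thesis by linarith
    qed
    finally show ?thesis .
  qed
  ultimately show "x \<in> FFLV_A (2 * n) ?b" by (simp add: FFLV_A_def)
qed

text \<open>
  The sum of all constraint functionals that are tight at a vertex of a polyhedron attains its
  maximum only there.
\<close>

lemma extreme_point_exposed:
  fixes C :: "(('v::real_vector \<Rightarrow> real) \<times> real) set"
  assumes fin: "finite C" and lin: "\<And>l c. (l, c) \<in> C \<Longrightarrow> linear l" and S: "subspace S"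
    and P: "P = {z \<in> S. \<forall>(l, c)\<in>C. l z \<le> c}"
    and x: "x extreme_point_of P"
  shows "\<exists>l :: _ \<Rightarrow> real. linear l \<and> (\<forall>z\<in>P. z \<noteq> x \<longrightarrow> l z < l x)"
proof -
  define T where "T = {lc \<in> C. fst lc x = snd lc}"
  define L where "L z = (\<Sum>lc\<in>T. fst lc z)" for z
  have xP: "x \<in> P" using x by (simp add: extreme_point_of_def)
  have linC: "linear (fst lc)" if "lc \<in> C" for lc using lin[of "fst lc" "snd lc"] that by simp
  have finT: "finite T" using fin by (simp add: T_def)
  have "linear L"
    unfolding L_def by (rule linear_compose_sum) (use linC in \<open>auto simp: T_def\<close>)
  moreover have "L z < L x" if z: "z \<in> P" "z \<noteq> x" for z
  proof -
    have le: "fst lc z \<le> fst lc x" if "lc \<in> T" for lc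
      using that z(1) by (auto simp: T_def P)
    then have "L z \<le> L x" unfolding L_def by (rule sum_mono)
    moreover have "L z \<noteq> L x"
    proof
      assume "L z = L x"
      then have eq: "fst lc z = fst lc x" if "lc \<in> T" for lc
        using sum_mono_inv[of "\<lambda>lc. fst lc z" T "\<lambda>lc. fst lc x" lc] le that finT
        by (simp add: L_def)
      \<comment> \<open>These points continue the segment from \<open>z\<close> slightly beyond
        \<open>x\<close>. Tight constraints are constant along the line and the others have slack,
        so small \<open>e\<close> stay in \<open>P\<close>, and \<open>x\<close> is inside a segment
        of \<open>P\<close>.\<close>
      define y where "y e = x - e *\<^sub>R (z - x)" for e :: real
      have val: "fst lc (y e) = fst lc x - e * (fst lc z - fst lc x)" if "lc \<in> C" for lc e
        using linC[OF that] by (simp add: y_def linear_diff linear_scale)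
      have "\<forall>\<^sub>F e in at_right 0. fst lc (y e) \<le> snd lc" if lc: "lc \<in> C" for lc
      proof (cases "lc \<in> T")
        case True
        then show ?thesis using eq[OF True] val[OF lc] by (simp add: T_def)
      next
        case False
        then have "fst lc x < snd lc" using lc xP by (force simp: T_def P)
        moreover have "((\<lambda>e. fst lc x - e * (fst lc z - fst lc x)) \<longlongrightarrow>
            fst lc x - 0 * (fst lc z - fst lc x)) (at_right 0)"
          by (intro tendsto_intros)
        ultimately have "\<forall>\<^sub>F e in at_right 0. fst lc x - e * (fst lc z - fst lc x) < snd lc"
          by (intro order_tendstoD(2)) auto
        then show ?thesis by (rule eventually_mono) (simp add: val[OF lc])
      qed
      then have "\<forall>\<^sub>F e in at_right 0. \<forall>lc\<in>C. fst lc (y e) \<le> snd lc"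
        using fin by (intro eventually_ball_finite) auto
      moreover have "\<forall>\<^sub>F e in at_right (0::real). 0 < e"
        by (rule eventually_at_right_less)
      ultimately have "\<forall>\<^sub>F e in at_right 0. (\<forall>lc\<in>C. fst lc (y e) \<le> snd lc) \<and> 0 < e"
        by (rule eventually_conj)
      then obtain e where e: "\<forall>lc\<in>C. fst lc (y e) \<le> snd lc" "0 < e"
        using eventually_happens'[OF trivial_limit_at_right_real] by blast
      have "y e \<in> S" using S xP z(1) unfolding y_def P
        by (auto intro!: subspace_diff subspace_scale)
      then have "y e \<in> P" using e(1) by (auto simp: P)
      moreover have "x \<in> open_segment (y e) z"
        unfolding in_segment
      proof (intro conjI exI[of _ "e / (1 + e)"])
        have "y e - z = - (1 + e) *\<^sub>R (z - x)" by (simp add: y_def algebra_simps)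
        then show "y e \<noteq> z" using e z(2) by auto
        have "(1 + e) *\<^sub>R ((1 - e / (1 + e)) *\<^sub>R y e + (e / (1 + e)) *\<^sub>R z) = y e + e *\<^sub>R z"
          using e by (simp add: scaleR_add_right field_simps)
        also have "\<dots> = (1 + e) *\<^sub>R x" by (simp add: y_def algebra_simps)
        finally show "x = (1 - e / (1 + e)) *\<^sub>R y e + (e / (1 + e)) *\<^sub>R z"
          using e by (metis add_pos_pos less_irrefl scaleR_left_imp_eq zero_less_one)
      qed (use e in \<open>auto simp: field_simps\<close>)
      ultimately show False using x z(1) by (auto simp: extreme_point_of_def)
    qed
    ultimately show ?thesis by simp
  qed
  ultimately show ?thesis by (intro exI[of _ L]) simp
qed

lemma point_eq_sum_single:
  assumes "x \<in> coord_space I" "finite I"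
  shows "x = (\<Sum>p\<in>I. coeff_at x p *\<^sub>R Poly_Mapping.single p 1)"
proof (rule poly_mapping_eqI)
  fix q
  have "coeff_at (\<Sum>p\<in>I. coeff_at x p *\<^sub>R Poly_Mapping.single p 1) q
      = (\<Sum>p\<in>I. if p = q then coeff_at x p else 0)"
    unfolding lookup_sum by (rule sum.cong) (auto simp: lookup_scaleR lookup_single)
  also have "\<dots> = coeff_at x q"
    using assms coeff_zero_outside[OF assms(1), of q] by simp
  finally show "coeff_at x q = coeff_at (\<Sum>p\<in>I. coeff_at x p *\<^sub>R Poly_Mapping.single p 1) q" ..
qed

lemma subspace_coord_space: "subspace (coord_space I)"
  unfolding subspace_def
  by (auto intro!: coord_spaceI simp: coeff_zero_outside lookup_add lookup_scaleR)

text \<open>There are only finitely many constraints, since Dyck paths are repetition-free lists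
  over a finite set. The weights \<open>w\<close> are the values of the exposing functional at the
  unit points.\<close>

lemma FFLV_C_vertex_exposed:
  assumes "x extreme_point_of FFLV_C n a"
  shows "\<exists>w. \<forall>z\<in>FFLV_C n a. z \<noteq> x \<longrightarrow>
    (\<Sum>p\<in>pairsC n. w p * coeff_at z p) < (\<Sum>p\<in>pairsC n. w p * coeff_at x p)"
proof -
  define D where "D = {d. dyck_pathC n d}"
  have "finite D"
    by (rule finite_subset[OF _ finite_subset_distinct[OF finite_pairsC[of n]]])
      (auto simp: D_def dyck_pathC_def dyck_distinct)
  define C where "C = (\<lambda>d. (\<lambda>z. path_sum z d, real (boundC n a d))) ` D
      \<union> (\<lambda>p. (\<lambda>z. - coeff_at z p, 0)) ` pairsC n"
  have "\<exists>l :: _ \<Rightarrow> real. linear l \<and> (\<forall>z\<in>FFLV_C n a. z \<noteq> x \<longrightarrow> l z < l x)"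
  proof (rule extreme_point_exposed[OF _ _ subspace_coord_space _ assms])
    show "finite C" using \<open>finite D\<close> finite_pairsC by (simp add: C_def)
    show "linear l" if "(l, c) \<in> C" for l c
      using that linear_path_sum linear_compose_neg[OF linear_coeff_at] by (auto simp: C_def)
    show "FFLV_C n a = {z \<in> coord_space (pairsC n). \<forall>(l, c)\<in>C. l z \<le> c}"
      unfolding FFLV_C_def C_def D_def ball_Un ball_simps by auto
  qed
  then obtain l :: "point \<Rightarrow> real" where l: "linear l" "\<And>z. z \<in> FFLV_C n a \<Longrightarrow> z \<noteq> x \<Longrightarrow> l z < l x" by blast
  have val: "l z = (\<Sum>p\<in>pairsC n. l (Poly_Mapping.single p 1) * coeff_at z p)"
    if "z \<in> FFLV_C n a" for z
  proof -
    have "z \<in> coord_space (pairsC n)" using that by (simp add: FFLV_C_def)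
    then have "l z = l (\<Sum>p\<in>pairsC n. coeff_at z p *\<^sub>R Poly_Mapping.single p 1)"
      using point_eq_sum_single finite_pairsC by metis
    also have "\<dots> = (\<Sum>p\<in>pairsC n. l (Poly_Mapping.single p 1) * coeff_at z p)"
      using l(1) by (simp add: linear_sum linear_scale mult.commute)
    finally show ?thesis .
  qed
  have x: "x \<in> FFLV_C n a" using assms by (simp add: extreme_point_of_def)
  show ?thesis
  proof (intro exI[of _ "\<lambda>p. l (Poly_Mapping.single p 1)"] ballI impI)
    fix z assume z: "z \<in> FFLV_C n a" "z \<noteq> x"
    show "(\<Sum>p\<in>pairsC n. l (Poly_Mapping.single p 1) * coeff_at z p)
        < (\<Sum>p\<in>pairsC n. l (Poly_Mapping.single p 1) * coeff_at x p)"
      using l(2)[OF z] unfolding val[OF z(1)] val[OF x] .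
  qed
qed

section \<open>Pairings with sums of antichains and generic functionals\<close>

lemma pairing_chi:
  fixes w :: "nat \<times> nat \<Rightarrow> real"
  assumes "finite I" "A \<subseteq> I"
  shows "(\<Sum>p\<in>I. w p * coeff_at (chi A) p) = (\<Sum>p\<in>A. w p)"
proof -
  have "finite A" using assms finite_subset by blast
  then have "(\<Sum>p\<in>I. w p * coeff_at (chi A) p) = (\<Sum>p\<in>I. if p \<in> A then w p else 0)"
    by (intro sum.cong) (auto simp: lookup_chi indicator_def)
  also have "\<dots> = (\<Sum>p\<in>I \<inter> A. w p)" using assms(1) by (simp add: sum.inter_restrict)
  finally show ?thesis using assms(2) by (simp add: Int_absorb1)
qed

lemma pairing_sum_chi:
  fixes w :: "nat \<times> nat \<Rightarrow> real"
  assumes "finite I" "\<And>i. i \<in> J \<Longrightarrow> A i \<subseteq> I"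
  shows "(\<Sum>p\<in>I. w p * coeff_at (\<Sum>i\<in>J. c i *\<^sub>R chi (A i)) p) = (\<Sum>i\<in>J. c i * (\<Sum>p\<in>A i. w p))"
proof -
  have "(\<Sum>p\<in>I. w p * coeff_at (\<Sum>i\<in>J. c i *\<^sub>R chi (A i)) p)
      = (\<Sum>p\<in>I. \<Sum>i\<in>J. c i * (w p * coeff_at (chi (A i)) p))"
    by (simp add: lookup_sum lookup_scaleR sum_distrib_left mult_ac)
  also have "\<dots> = (\<Sum>i\<in>J. \<Sum>p\<in>I. c i * (w p * coeff_at (chi (A i)) p))"
    by (rule sum.swap)
  also have "\<dots> = (\<Sum>i\<in>J. c i * (\<Sum>p\<in>A i. w p))"
    using assms by (intro sum.cong) (simp_all add: sum_distrib_left[symmetric] pairing_chi)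
  finally show ?thesis .
qed

text \<open>Extending \<open>w\<close> by zero outside the type C pairs lets every antichain of
  \<open>Q (2 * n) k\<close> be cut down to one of \<open>QC n k\<close> of the same weight.\<close>

lemma functional_le_antichain_bounds_C:
  assumes x: "x \<in> FFLV_A (2 * n) b" "x \<in> coord_space (pairsC n)" and b: "\<And>k. n < k \<Longrightarrow> b k = 0"
    and w: "\<And>k A. k \<in> {1..n} \<Longrightarrow> 0 < b k \<Longrightarrow> A \<subseteq> QC n k \<Longrightarrow> antichain A \<Longrightarrow> (\<Sum>p\<in>A. w p) \<le> M k"
  shows "(\<Sum>p\<in>pairsC n. w p * coeff_at x p) \<le> (\<Sum>k=1..n. real (b k) * M k)"
proof -
  let ?w = "\<lambda>p. if p \<in> pairsC n then w p else 0"
  have "(\<Sum>p\<in>pairsC n. w p * coeff_at x p) = (\<Sum>p\<in>pairsA (2 * n). ?w p * coeff_at x p)"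
    using pairsC_subset_pairsA finite_pairsA by (intro sum.mono_neutral_cong_left) auto
  also have "\<dots> \<le> (\<Sum>k=1..<2 * n. real (b k) * M k)"
  proof (rule functional_le_antichain_bounds[OF x(1)])
    fix k A assume k: "k \<in> {1..<2 * n}" "0 < b k" and A: "A \<subseteq> Q (2 * n) k" "antichain A"
    have "finite A" using A(1) finite_Q finite_subset by blast
    then have "(\<Sum>p\<in>A. ?w p) = (\<Sum>p\<in>A \<inter> pairsC n. w p)"
      by (simp add: sum.inter_restrict)
    also have "\<dots> \<le> M k"
    proof (rule w)
      show "k \<in> {1..n}" using b[of k] k by (cases "n < k") auto
      show "A \<inter> pairsC n \<subseteq> QC n k" using A(1) Q_inter_pairsC_subset_QC by blast
      show "antichain (A \<inter> pairsC n)" using A(2) by (rule antichain_subset) auto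
    qed fact
    finally show "(\<Sum>p\<in>A. ?w p) \<le> M k" .
  qed
  also have "\<dots> = (\<Sum>k=1..n. real (b k) * M k)"
  proof (cases "n = 0")
    case False
    have "(\<Sum>k=1..<2 * n. real (b k) * M k) = (\<Sum>k\<in>{1..n} \<inter> {1..<2 * n}. real (b k) * M k)"
    proof (rule sum.mono_neutral_right)
      show "\<forall>k\<in>{1..<2 * n} - {1..n} \<inter> {1..<2 * n}. real (b k) * M k = 0"
      proof
        fix k assume "k \<in> {1..<2 * n} - {1..n} \<inter> {1..<2 * n}"
        then have "n < k" by auto
        then show "real (b k) * M k = 0" using b by simp
      qed
    qed auto
    also have "\<dots> = (\<Sum>k=1..n. real (b k) * M k)"
      using False by (intro sum.mono_neutral_left) auto
    finally show ?thesis .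
  qed simp
  finally show ?thesis .
qed

text \<open>Sums of distinct powers of 2 determine the subset, so adding a multiple \<open>e\<close>
  of \<open>g\<close> separates two given subsets for all but one value of \<open>e\<close>. The
  finitely many strict inequalities survive for small \<open>e\<close>.\<close>

lemma generic_perturbation:
  fixes w :: "nat \<times> nat \<Rightarrow> real"
  assumes "finite I" "finite V"
    and V: "\<And>z. z \<in> V \<Longrightarrow> (\<Sum>p\<in>I. w p * coeff_at z p) < (\<Sum>p\<in>I. w p * coeff_at x p)"
  shows "\<exists>w'. (\<forall>z\<in>V. (\<Sum>p\<in>I. w' p * coeff_at z p) < (\<Sum>p\<in>I. w' p * coeff_at x p)) \<and>
    inj_on (\<lambda>A. \<Sum>p\<in>A. w' p) (Pow I)"
proof -
  define g :: "nat \<times> nat \<Rightarrow> real" where "g p = 2 ^ prod_encode p" for p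
  have g_inj: "A = B" if "A \<subseteq> I" "B \<subseteq> I" "(\<Sum>p\<in>A. g p) = (\<Sum>p\<in>B. g p)" for A B
  proof -
    have fin: "finite A" "finite B" using that assms(1) finite_subset by blast+
    have enc: "(\<Sum>p\<in>A. g p) = real (set_encode (prod_encode ` A))" for A
      by (simp add: set_encode_def g_def sum.reindex inj_prod_encode)
    then have "set_encode (prod_encode ` A) = set_encode (prod_encode ` B)"
      using that(3) by simp
    then have "prod_encode ` A = prod_encode ` B"
      using fin by (simp add: set_encode_eq)
    then show ?thesis using inj_image_eq_iff[OF inj_prod_encode] by blast
  qed
  define W where "W e p = w p + e * g p" for e p
  have lin: "(\<Sum>p\<in>I. W e p * f p) = (\<Sum>p\<in>I. w p * f p) + e * (\<Sum>p\<in>I. g p * f p)" for e f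
    by (simp add: W_def algebra_simps sum.distrib sum_distrib_left)
  have linA: "(\<Sum>p\<in>A. W e p) = (\<Sum>p\<in>A. w p) + e * (\<Sum>p\<in>A. g p)" for e A
    by (simp add: W_def sum.distrib sum_distrib_left)
  have "\<forall>\<^sub>F e in at_right 0. (\<Sum>p\<in>I. W e p * coeff_at z p) < (\<Sum>p\<in>I. W e p * coeff_at x p)"
    if "z \<in> V" for z
  proof -
    have "((\<lambda>e. (\<Sum>p\<in>I. w p * coeff_at y p) + e * (\<Sum>p\<in>I. g p * coeff_at y p)) \<longlongrightarrow>
        (\<Sum>p\<in>I. w p * coeff_at y p) + 0 * (\<Sum>p\<in>I. g p * coeff_at y p)) (at_right 0)" for y
      by (intro tendsto_intros)
    then have "((\<lambda>e. \<Sum>p\<in>I. W e p * coeff_at y p) \<longlongrightarrow> (\<Sum>p\<in>I. w p * coeff_at y p)) (at_right 0)" for y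
      unfolding lin by simp
    then have "((\<lambda>e. (\<Sum>p\<in>I. W e p * coeff_at x p) - (\<Sum>p\<in>I. W e p * coeff_at z p)) \<longlongrightarrow>
        (\<Sum>p\<in>I. w p * coeff_at x p) - (\<Sum>p\<in>I. w p * coeff_at z p)) (at_right 0)"
      by (intro tendsto_diff)
    then have "\<forall>\<^sub>F e in at_right 0. 0 < (\<Sum>p\<in>I. W e p * coeff_at x p) - (\<Sum>p\<in>I. W e p * coeff_at z p)"
      using V[OF that] by (intro order_tendstoD(1)) auto
    then show ?thesis by (rule eventually_mono) simp
  qed
  then have "\<forall>\<^sub>F e in at_right 0. \<forall>z\<in>V. (\<Sum>p\<in>I. W e p * coeff_at z p) < (\<Sum>p\<in>I. W e p * coeff_at x p)"
    using assms(2) by (intro eventually_ball_finite) auto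
  moreover
  have "\<forall>\<^sub>F e in at_right 0. (\<Sum>p\<in>A. W e p) = (\<Sum>p\<in>B. W e p) \<longrightarrow> A = B" if AB: "A \<subseteq> I" "B \<subseteq> I" for A B
  proof (cases "A = B")
    case False
    then have ne: "(\<Sum>p\<in>A. g p) - (\<Sum>p\<in>B. g p) \<noteq> 0" using g_inj AB by auto
    \<comment> \<open>The only value of \<open>e\<close> at which the two subset sums agree.\<close>
    define c where "c = ((\<Sum>p\<in>B. w p) - (\<Sum>p\<in>A. w p)) / ((\<Sum>p\<in>A. g p) - (\<Sum>p\<in>B. g p))"
    have "\<forall>\<^sub>F e in at_right 0. e \<noteq> c" by (rule eventually_neq_at_within)
    then show ?thesis
    proof (rule eventually_mono)
      fix e assume "e \<noteq> c"
      then have "e * ((\<Sum>p\<in>A. g p) - (\<Sum>p\<in>B. g p)) \<noteq> (\<Sum>p\<in>B. w p) - (\<Sum>p\<in>A. w p)"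
        using ne by (auto simp: c_def field_simps)
      then show "(\<Sum>p\<in>A. W e p) = (\<Sum>p\<in>B. W e p) \<longrightarrow> A = B"
        unfolding linA by (auto simp: algebra_simps)
    qed
  qed simp
  then have "\<forall>\<^sub>F e in at_right 0. \<forall>A\<in>Pow I. \<forall>B\<in>Pow I. (\<Sum>p\<in>A. W e p) = (\<Sum>p\<in>B. W e p) \<longrightarrow> A = B"
    using assms(1) by (intro eventually_ball_finite ballI) auto
  ultimately have "\<forall>\<^sub>F e in at_right 0.
      (\<forall>z\<in>V. (\<Sum>p\<in>I. W e p * coeff_at z p) < (\<Sum>p\<in>I. W e p * coeff_at x p)) \<and>
      (\<forall>A\<in>Pow I. \<forall>B\<in>Pow I. (\<Sum>p\<in>A. W e p) = (\<Sum>p\<in>B. W e p) \<longrightarrow> A = B)"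
    by (rule eventually_conj)
  from eventually_happens'[OF trivial_limit_at_right_real this]
  obtain e where "(\<forall>z\<in>V. (\<Sum>p\<in>I. W e p * coeff_at z p) < (\<Sum>p\<in>I. W e p * coeff_at x p)) \<and>
      (\<forall>A\<in>Pow I. \<forall>B\<in>Pow I. (\<Sum>p\<in>A. W e p) = (\<Sum>p\<in>B. W e p) \<longrightarrow> A = B)"
    by (elim exE)
  then show ?thesis by (intro exI[of _ "W e"]) (simp add: inj_on_def)
qed

text \<open>The polytope is of type A, but maximality is known only among type C antichains. The
  ends of a segment through the point vanish outside \<open>pairsC n\<close>, as the point does, so
  the type C bound applies and both ends maximize \<open>w\<close>. The same holds after a small
  change of \<open>w\<close> in one coordinate, and comparing the two recovers that
  coordinate.\<close>

lemma chi_add_extreme_if_unique_maximizers: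
  fixes w :: "nat \<times> nat \<Rightarrow> real"
  assumes i: "i \<in> {1..<n}"
    and A: "A \<subseteq> QC n i" "antichain A" and B: "B \<subseteq> QC n (i + 1)" "antichain B"
    and maxA: "\<And>X. X \<subseteq> QC n i \<Longrightarrow> antichain X \<Longrightarrow> X \<noteq> A \<Longrightarrow> (\<Sum>p\<in>X. w p) < (\<Sum>p\<in>A. w p)"
    and maxB: "\<And>X. X \<subseteq> QC n (i + 1) \<Longrightarrow> antichain X \<Longrightarrow> X \<noteq> B \<Longrightarrow> (\<Sum>p\<in>X. w p) < (\<Sum>p\<in>B. w p)"
  shows "(chi A + chi B) extreme_point_of FFLV_A (2 * n) (\<lambda>k. omegaA i k + omegaA (i + 1) k)"
proof -
  let ?b = "\<lambda>k. omegaA i k + omegaA (i + 1) k"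
  let ?x = "chi A + chi B"
  let ?pair = "\<lambda>w z. \<Sum>p\<in>pairsC n. w p * coeff_at z p"
  have fA: "finite A" and fB: "finite B" using A B finite_QC finite_subset by blast+
  have AC: "A \<subseteq> pairsC n" and BC: "B \<subseteq> pairsC n" using A B QC_subset_pairsC by blast+
  have pair_x: "?pair w ?x = (\<Sum>p\<in>A. w p) + (\<Sum>p\<in>B. w p)" for w
    using pairing_chi[OF finite_pairsC AC] pairing_chi[OF finite_pairsC BC]
    by (simp add: lookup_add distrib_left sum.distrib)
  have bound: "?pair w z \<le> ?pair w ?x"
    if z: "z \<in> FFLV_A (2 * n) ?b" "z \<in> coord_space (pairsC n)"
      and mA: "\<And>X. X \<subseteq> QC n i \<Longrightarrow> antichain X \<Longrightarrow> (\<Sum>p\<in>X. w p) \<le> (\<Sum>p\<in>A. w p)"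
      and mB: "\<And>X. X \<subseteq> QC n (i + 1) \<Longrightarrow> antichain X \<Longrightarrow> (\<Sum>p\<in>X. w p) \<le> (\<Sum>p\<in>B. w p)" for w z
  proof -
    let ?M = "\<lambda>k. if k = i then \<Sum>p\<in>A. w p else \<Sum>p\<in>B. w p"
    have "?pair w z \<le> (\<Sum>k=1..n. real (?b k) * ?M k)"
      by (rule functional_le_antichain_bounds_C[OF z])
        (use i mA mB in \<open>auto simp: omegaA_def split: if_splits\<close>)
    also have "\<dots> = (\<Sum>k\<in>{i, i + 1}. real (?b k) * ?M k)"
      using i by (intro sum.mono_neutral_right) (auto simp: omegaA_def)
    also have "\<dots> = ?pair w ?x" by (simp add: pair_x omegaA_def)
    finally show ?thesis .
  qed
  have eq: "y = ?x" if y: "y \<in> FFLV_A (2 * n) ?b" and z: "z \<in> FFLV_A (2 * n) ?b"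
    and u: "0 < u" "u < 1" "?x = (1 - u) *\<^sub>R y + u *\<^sub>R z" for y z u
  proof -
    have nonneg: "0 \<le> coeff_at y p" "0 \<le> coeff_at z p" for p
      using y z coeff_zero_outside[of y "pairsA (2 * n)" p] coeff_zero_outside[of z "pairsA (2 * n)" p]
      by (cases "p \<in> pairsA (2 * n)"; auto simp: FFLV_A_def)+
    have zero: "coeff_at y p = 0 \<and> coeff_at z p = 0" if "p \<notin> pairsC n" for p
    proof -
      have "coeff_at ?x p = 0" using that AC BC fA fB by (auto simp: lookup_add lookup_chi indicator_def)
      then have "(1 - u) * coeff_at y p + u * coeff_at z p = 0"
        by (simp only: u(3) lookup_add lookup_scaleR)
      moreover have "0 \<le> (1 - u) * coeff_at y p" "0 \<le> u * coeff_at z p"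
        using u nonneg by auto
      ultimately have "(1 - u) * coeff_at y p = 0" "u * coeff_at z p = 0" by linarith+
      then show ?thesis using u by simp
    qed
    have yC: "y \<in> coord_space (pairsC n)" and zC: "z \<in> coord_space (pairsC n)"
      using zero by (auto intro!: coord_spaceI)
    have pair_eq: "?pair w y = ?pair w ?x"
      if mA: "\<And>X. X \<subseteq> QC n i \<Longrightarrow> antichain X \<Longrightarrow> (\<Sum>p\<in>X. w p) \<le> (\<Sum>p\<in>A. w p)"
        and mB: "\<And>X. X \<subseteq> QC n (i + 1) \<Longrightarrow> antichain X \<Longrightarrow> (\<Sum>p\<in>X. w p) \<le> (\<Sum>p\<in>B. w p)" for w
    proof -
      have "?pair w ?x = (1 - u) * ?pair w y + u * ?pair w z"
        unfolding u(3) by (simp add: lookup_add lookup_scaleR distrib_left sum.distrib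
            sum_distrib_left mult.left_commute)
      moreover have "u * ?pair w z \<le> u * ?pair w ?x"
        using bound[OF z zC mA mB] u by (intro mult_left_mono) auto
      ultimately have "(1 - u) * ?pair w ?x \<le> (1 - u) * ?pair w y" by (simp add: algebra_simps)
      then have "?pair w ?x \<le> ?pair w y" using u by simp
      then show ?thesis using bound[OF y yC mA mB] by simp
    qed
    show "y = ?x"
    proof (rule poly_mapping_eqI)
      fix q
      show "coeff_at y q = coeff_at ?x q"
      proof (cases "q \<in> pairsC n")
        case False
        then show ?thesis using zero AC BC fA fB by (auto simp: lookup_add lookup_chi indicator_def)
      next
        case True
        define V where "V e p = w p + (if p = q then e else 0)" for e p
        have V_sum: "(\<Sum>p\<in>X. V e p) = (\<Sum>p\<in>X. w p) + (if q \<in> X then e else 0)" if "finite X" for e X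
          using that by (simp add: V_def sum.distrib)
        \<comment> \<open>The maximizers are strict, so they survive a small change of \<open>w\<close> in one coordinate.\<close>
        have ev: "\<forall>\<^sub>F e in at_right 0. \<forall>X\<in>{X. X \<subseteq> QC n k \<and> antichain X}. (\<Sum>p\<in>X. V e p) \<le> (\<Sum>p\<in>Y. V e p)"
          if Y: "finite Y"
            and mx: "\<And>X. X \<subseteq> QC n k \<Longrightarrow> antichain X \<Longrightarrow> X \<noteq> Y \<Longrightarrow> (\<Sum>p\<in>X. w p) < (\<Sum>p\<in>Y. w p)" for k Y
        proof (rule eventually_ball_finite)
          show "finite {X. X \<subseteq> QC n k \<and> antichain X}"
            using finite_QC[of n k] by simp
          show "\<forall>X\<in>{X. X \<subseteq> QC n k \<and> antichain X}.
              \<forall>\<^sub>F e in at_right 0. (\<Sum>p\<in>X. V e p) \<le> (\<Sum>p\<in>Y. V e p)"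
          proof
            fix X assume X: "X \<in> {X. X \<subseteq> QC n k \<and> antichain X}"
            then have fX: "finite X" using finite_QC finite_subset by blast
            show "\<forall>\<^sub>F e in at_right 0. (\<Sum>p\<in>X. V e p) \<le> (\<Sum>p\<in>Y. V e p)"
            proof (cases "X = Y")
              case False
              define c where "c = (\<Sum>p\<in>Y. w p) - (\<Sum>p\<in>X. w p)"
              have c: "0 < c" using mx[of X] X False by (simp add: c_def)
              have "\<forall>\<^sub>F e in at_right 0. e \<in> {0<..<c}"
                using c by (rule eventually_at_right_real)
              then show ?thesis
                by (rule eventually_mono) (auto simp: V_sum[OF fX] V_sum[OF Y] c_def)
            qed simp
          qed
        qed
        have evA: "\<forall>\<^sub>F e in at_right 0. \<forall>X\<in>{X. X \<subseteq> QC n i \<and> antichain X}. (\<Sum>p\<in>X. V e p) \<le> (\<Sum>p\<in>A. V e p)"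
          using fA maxA by (rule ev)
        have evB: "\<forall>\<^sub>F e in at_right 0. \<forall>X\<in>{X. X \<subseteq> QC n (i + 1) \<and> antichain X}. (\<Sum>p\<in>X. V e p) \<le> (\<Sum>p\<in>B. V e p)"
          using fB maxB by (rule ev)
        have ev0: "\<forall>\<^sub>F e in at_right (0::real). 0 < e"
          by (rule eventually_at_right_less)
        from eventually_happens'[OF trivial_limit_at_right_real
            eventually_conj[OF ev0 eventually_conj[OF evA evB]]]
        obtain e where e: "0 < e"
          "\<And>X. X \<subseteq> QC n i \<Longrightarrow> antichain X \<Longrightarrow> (\<Sum>p\<in>X. V e p) \<le> (\<Sum>p\<in>A. V e p)"
          "\<And>X. X \<subseteq> QC n (i + 1) \<Longrightarrow> antichain X \<Longrightarrow> (\<Sum>p\<in>X. V e p) \<le> (\<Sum>p\<in>B. V e p)"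
          by auto
        have "?pair w y = ?pair w ?x"
        proof (rule pair_eq)
          show "(\<Sum>p\<in>X. w p) \<le> (\<Sum>p\<in>A. w p)" if "X \<subseteq> QC n i" "antichain X" for X
            using maxA[OF that] by (cases "X = A") auto
          show "(\<Sum>p\<in>X. w p) \<le> (\<Sum>p\<in>B. w p)" if "X \<subseteq> QC n (i + 1)" "antichain X" for X
            using maxB[OF that] by (cases "X = B") auto
        qed
        moreover have "?pair (V e) y = ?pair (V e) ?x"
          using e(2,3) by (rule pair_eq)
        moreover have "?pair (V e) z = ?pair w z + e * coeff_at z q" for z
        proof -
          have "?pair (V e) z = ?pair w z + (\<Sum>p\<in>pairsC n. if p = q then e * coeff_at z p else 0)"
            unfolding sum.distrib[symmetric] by (rule sum.cong) (auto simp: V_def algebra_simps)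
          then show ?thesis using True finite_pairsC by simp
        qed
        ultimately show ?thesis using e(1) by simp
      qed
    qed
  qed
  have "?x \<notin> open_segment y z" if y: "y \<in> FFLV_A (2 * n) ?b" and z: "z \<in> FFLV_A (2 * n) ?b" for y z
  proof
    assume "?x \<in> open_segment y z"
    then obtain u where u: "0 < u" "u < 1" "?x = (1 - u) *\<^sub>R y + u *\<^sub>R z" and "y \<noteq> z"
      by (auto simp: in_segment)
    have "y = ?x" using eq[OF y z u] .
    moreover have "z = ?x" using eq[OF z y, of "1 - u"] u by (simp add: add.commute)
    ultimately show False using \<open>y \<noteq> z\<close> by simp
  qed
  moreover have "?x \<in> FFLV_A (2 * n) ?b"
    using A B QC_subset_Q by (intro chi_add_in_FFLV_A) blast+
  ultimately show ?thesis by (simp add: extreme_point_of_def)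
qed

text \<open>The perturbed functional prefers \<open>x\<close> strictly to all other sums of
  antichains, while by the support function bound the sum of the maximizing antichains does at least
  as well as \<open>x\<close>. So \<open>x\<close> is that sum, and injectivity on subsets makes
  each maximizer unique.\<close>

lemma FFLV_C_vertex_decomposition:
  assumes ext: "x extreme_point_of FFLV_C n a"
  shows "\<exists>A. (\<forall>i\<in>{1..n}. A i \<subseteq> QC n i \<and> antichain (A i)) \<and>
       (\<forall>i\<in>{1..<n}. (chi (A i) + chi (A (i + 1))) extreme_point_of
          FFLV_A (2 * n) (\<lambda>k. omegaA i k + omegaA (i + 1) k)) \<and>
       x = (\<Sum>i = 1..n. real (a i) *\<^sub>R chi (A i))"
proof -
  have xC: "x \<in> FFLV_C n a" using ext by (simp add: extreme_point_of_def)
  define AC where "AC i = {A. A \<subseteq> QC n i \<and> antichain A}" for i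
  have finAC: "finite (AC i)" for i
    using finite_QC[of n i] by (simp add: AC_def)
  \<comment> \<open>Only finitely many competitors are kept, so that the exposing functional can be
    perturbed against all of them at once.\<close>
  define V where "V = (\<lambda>A. \<Sum>i=1..n. real (a i) *\<^sub>R chi (A i)) ` (PiE {1..n} AC)"
  have "finite V" unfolding V_def using finAC by (intro finite_imageI finite_PiE) auto
  have V: "z \<in> FFLV_C n a" if "z \<in> V" for z
  proof -
    obtain A where A: "A \<in> PiE {1..n} AC" "z = (\<Sum>i=1..n. real (a i) *\<^sub>R chi (A i))"
      using \<open>z \<in> V\<close> by (auto simp: V_def)
    have "A i \<in> AC i" if "i \<in> {1..n}" for i using A(1) that by (rule PiE_mem)
    then show ?thesis unfolding A(2) by (intro sum_chi_in_FFLV_C) (auto simp: AC_def)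
  qed
  obtain w0 where "\<forall>z\<in>FFLV_C n a. z \<noteq> x \<longrightarrow>
      (\<Sum>p\<in>pairsC n. w0 p * coeff_at z p) < (\<Sum>p\<in>pairsC n. w0 p * coeff_at x p)"
    using FFLV_C_vertex_exposed[OF ext] by blast
  then obtain w where
    w: "\<forall>z\<in>V - {x}. (\<Sum>p\<in>pairsC n. w p * coeff_at z p) < (\<Sum>p\<in>pairsC n. w p * coeff_at x p)"
    and inj: "inj_on (\<lambda>A. \<Sum>p\<in>A. w p) (Pow (pairsC n))"
    using generic_perturbation[OF finite_pairsC[of n], of "V - {x}" w0 x] \<open>finite V\<close> V by auto
  have "\<exists>A\<in>AC i. \<forall>X\<in>AC i. (\<Sum>p\<in>X. w p) \<le> (\<Sum>p\<in>A. w p)" for i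
  proof -
    have ne: "{} \<in> AC i" by (simp add: AC_def antichain_def)
    let ?S = "(\<lambda>X. \<Sum>p\<in>X. w p) ` AC i"
    have "Max ?S \<in> ?S" using finAC ne by (intro Max_in) auto
    then obtain A where "A \<in> AC i" "Max ?S = (\<Sum>p\<in>A. w p)" by auto
    then show ?thesis using finAC Max_ge[of ?S] by (intro bexI[of _ A]) auto
  qed
  then obtain A where A: "\<And>i. A i \<in> AC i" "\<And>i X. X \<in> AC i \<Longrightarrow> (\<Sum>p\<in>X. w p) \<le> (\<Sum>p\<in>A i. w p)"
    by metis
  have sub: "A i \<subseteq> QC n i" and anti: "antichain (A i)" for i using A(1)[of i] by (auto simp: AC_def)
  have strict: "(\<Sum>p\<in>X. w p) < (\<Sum>p\<in>A i. w p)" if "X \<subseteq> QC n i" "antichain X" "X \<noteq> A i" for i X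
  proof -
    have "(\<Sum>p\<in>X. w p) \<noteq> (\<Sum>p\<in>A i. w p)"
      using inj_onD[OF inj, of X "A i"] that sub[of i] QC_subset_pairsC by blast
    then show ?thesis using A(2)[of X i] that by (simp add: AC_def)
  qed
  let ?v = "\<Sum>i=1..n. real (a i) *\<^sub>R chi (A i)"
  have "x = ?v"
  proof (rule ccontr)
    assume "x \<noteq> ?v"
    have "?v = (\<Sum>i=1..n. real (a i) *\<^sub>R chi (restrict A {1..n} i))"
      by (intro sum.cong) auto
    moreover have "restrict A {1..n} \<in> PiE {1..n} AC" using A(1) by auto
    ultimately have "?v \<in> V" unfolding V_def by (rule image_eqI)
    then have "(\<Sum>p\<in>pairsC n. w p * coeff_at ?v p) < (\<Sum>p\<in>pairsC n. w p * coeff_at x p)"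
      using w \<open>x \<noteq> ?v\<close> by blast
    also have "\<dots> \<le> (\<Sum>k=1..n. real (if k \<le> n then a k else 0) * (\<Sum>p\<in>A k. w p))"
    proof (rule functional_le_antichain_bounds_C)
      show "x \<in> FFLV_A (2 * n) (\<lambda>k. if k \<le> n then a k else 0)"
        using xC FFLV_C_subset_FFLV_A by blast
      show "x \<in> coord_space (pairsC n)" using xC by (simp add: FFLV_C_def)
    qed (use A(2) in \<open>auto simp: AC_def\<close>)
    also have "\<dots> = (\<Sum>k=1..n. real (a k) * (\<Sum>p\<in>A k. w p))" by (intro sum.cong) auto
    also have "\<dots> = (\<Sum>p\<in>pairsC n. w p * coeff_at ?v p)"
      using sub QC_subset_pairsC by (intro pairing_sum_chi[symmetric] finite_pairsC) blast
    finally show False by simp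
  qed
  moreover have "(chi (A i) + chi (A (i + 1))) extreme_point_of
      FFLV_A (2 * n) (\<lambda>k. omegaA i k + omegaA (i + 1) k)" if "i \<in> {1..<n}" for i
    by (rule chi_add_extreme_if_unique_maximizers[OF that sub anti sub anti strict strict])
  ultimately show ?thesis using sub anti by (intro exI[of _ A]) blast
qed

theorem theorem5p1:
  fixes n :: nat and a :: weight and x :: point
  assumes "1 \<le> n"
    and "x \<in> coord_space (pairsC n)"
  shows "x extreme_point_of FFLV_C n a \<longleftrightarrow>
    (\<exists>A :: nat \<Rightarrow> (nat \<times> nat) set.
       (\<forall>i\<in>{1..n}. A i \<subseteq> QC n i \<and> antichain (A i)) \<and>
       (\<forall>i\<in>{1..<n}. (chi (A i) + chi (A (i + 1))) extreme_point_of
          FFLV_A (2 * n) (\<lambda>k. omegaA i k + omegaA (i + 1) k)) \<and>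
       x = (\<Sum>i = 1..n. real (a i) *\<^sub>R chi (A i)))"
proof
  assume "x extreme_point_of FFLV_C n a"
  then show "\<exists>A :: nat \<Rightarrow> (nat \<times> nat) set.
       (\<forall>i\<in>{1..n}. A i \<subseteq> QC n i \<and> antichain (A i)) \<and>
       (\<forall>i\<in>{1..<n}. (chi (A i) + chi (A (i + 1))) extreme_point_of
          FFLV_A (2 * n) (\<lambda>k. omegaA i k + omegaA (i + 1) k)) \<and>
       x = (\<Sum>i = 1..n. real (a i) *\<^sub>R chi (A i))"
    by (rule FFLV_C_vertex_decomposition)
next
  assume "\<exists>A :: nat \<Rightarrow> (nat \<times> nat) set.
       (\<forall>i\<in>{1..n}. A i \<subseteq> QC n i \<and> antichain (A i)) \<and>
       (\<forall>i\<in>{1..<n}. (chi (A i) + chi (A (i + 1))) extreme_point_of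
          FFLV_A (2 * n) (\<lambda>k. omegaA i k + omegaA (i + 1) k)) \<and>
       x = (\<Sum>i = 1..n. real (a i) *\<^sub>R chi (A i))"
  then obtain A where A: "\<forall>i\<in>{1..n}. A i \<subseteq> QC n i \<and> antichain (A i)"
      "\<forall>i\<in>{1..<n}. (chi (A i) + chi (A (i + 1))) extreme_point_of
          FFLV_A (2 * n) (\<lambda>k. omegaA i k + omegaA (i + 1) k)"
      "x = (\<Sum>i = 1..n. real (a i) *\<^sub>R chi (A i))"
    by blast
  interpret compatible_antichains n A
    by unfold_locales (use A in blast)+
  show "x extreme_point_of FFLV_C n a"
    unfolding A(3) by (rule extreme_point_sum_chi)
qed

end
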